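(* Let $1\le p<2$. There are constants $c_0,c>0$ such that for all $n,N\in\mathbb{N}$ with $n\ge c_0\sqrt{N}$, $$ e_n^q(S_N,\mathcal{B}_p^N)\le c\, n^{-2/p}N^{2/p-1}\max\big(\log(n/\sqrt{N}),1\big)^{2/p-1}. $$
   Context: Throughout, $\log=\log_2$, $\mathbb{N}=\{1,2,\dots\}$, $\mathbb{N}_0=\mathbb{N}\cup\{0\}$, and $\mathbb{Z}[0,N)=\{0,\dots,N-1\}$. Quantum model. Let $D,K$ be nonempty sets, $F$ a nonempty set of functions $D\to K$, $G$ a normed space over $\mathbb{R}$ or $\mathbb{C}$, and $S:F\to G$. Let $H_m=(\mathbb{C}^2)^{\otimes m}$ with canonical basis $|i\rangle$, $i\in\mathbb{Z}[0,2^m)$ (via binary expansion). A quantum query is a tuple $Q=(m,m',m'',Z,\tau,\beta)$ with $m,m',m''\in\mathbb{N}$, $m'+m''\le m$, $\emptyset\ne Z\subseteq\mathbb{Z}[0,2^{m'})$, $\tau:Z\to D$, $\beta:K\to\mathbb{Z}[0,2^{m''})$. For $f\in F$ the unitary $Q_f$ on $H_m=H_{m'}\otimes H_{m''}\otimes H_{m-m'-m''}$ is given on basis states by $Q_f|i\rangle|x\rangle|y\rangle=|i\rangle|x\oplus\beta(f(\tau(i)))\rangle|y\rangle$ if $i\in Z$ and $Q_f|i\rangle|x\rangle|y\rangle=|i\rangle|x\rangle|y\rangle$ otherwise, where $\oplus$ is addition mod $2^{m''}$. A quantum algorithm with no measurement is $(Q,(U_j)_{j=0}^n)$ with $n\in\mathbb{N}_0$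 and unitaries $U_j$ on $H_{m}$, $m=m(Q)$; it defines $A_f=U_nQ_fU_{n-1}\cdots U_1Q_fU_0$ and uses $n$ queries; $A_f(x,y)$ denotes its matrix entries in the canonical basis. A quantum algorithm from $F$ to $G$ with $k\in\mathbb{N}$ measurements is $A=((A_\ell)_{\ell=0}^{k-1},(b_\ell)_{\ell=0}^{k-1},\varphi)$, where each $A_\ell$ is an algorithm with no measurement on $m_\ell$ qubits, $b_0\in\mathbb{Z}[0,2^{m_0})$, $b_\ell:\prod_{i<\ell}\mathbb{Z}[0,2^{m_i})\to\mathbb{Z}[0,2^{m_\ell})$ for $1\le\ell\le k-1$, and $\varphi:\prod_{\ell<k}\mathbb{Z}[0,2^{m_\ell})\to G$. Its output on $f$ is the probability measure $A(f)$ on $G$ which is the distribution of $\varphi(x_0,\dots,x_{k-1})$, where $(x_0,\dots,x_{k-1})$ has probability $\prod_{\ell=0}^{k-1}|A_{\ell,f}(x_\ell,b_\ell(x_0,\dots,x_{\ell-1}))|^2$ (with $b_0$ a constant). Its number of queries is $n_q(A)=\sum_\ell n_q(A_\ell)$. For a random variable $\zeta$ with distribution $A(f)$, let $e(S,A,f)=\inf\{\varepsilon:\ \mathbf{P}\{\|S(f)-\zeta\|>\varepsilon\}\le 1/4\}$, $e(S,A,F)=\sup_{f\in F}e(S,A,f)$, and the $n$-th minimal query error is $e_n^q(S,F)=\inf\{e(S,A,F): A \text{ a quantum algorithm from } F \text{ to } G \text{ with } n_q(A)\le n\}$. Summation setting. For $N\in\mathbb{N}$, $D=\mathbb{Z}[0,N)$,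 $K=G=\mathbb{R}$. For $1\le p<\infty$, $L_p^N$ is the space of functions $f:\mathbb{Z}[0,N)\to\mathbb{R}$ with norm $\|f\|_{L_p^N}=\big(\frac1N\sum_{i=0}^{N-1}|f(i)|^p\big)^{1/p}$; $\mathcal{B}_p^N=\{f\in L_p^N:\|f\|_{L_p^N}\le 1\}$; and $S_N f=\frac1N\sum_{i=0}^{N-1}f(i)$. *)

theory Defs
  imports "HOL-Analysis.Analysis"
begin

text \<open>Quantum query model (Heinrich). Basis states of H_m are indexed by nat < 2^m;
operators on H_m are complex matrices given as functions nat => nat => complex
(only entries with indices < 2^m matter).\<close>

type_synonym cmat = "nat \<Rightarrow> nat \<Rightarrow> complex"

record ('d, 'k) qquery =
  qm   :: nat
  qm1  :: nat
  qm2  :: nat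
  qZ   :: "nat set"
  qtau :: "nat \<Rightarrow> 'd"
  qbeta :: "'k \<Rightarrow> nat"

definition valid_query :: "'d set \<Rightarrow> ('d, 'k) qquery \<Rightarrow> bool" where
  "valid_query D Q \<longleftrightarrow> 1 \<le> qm1 Q \<and> 1 \<le> qm2 Q \<and> qm1 Q + qm2 Q \<le> qm Q
     \<and> qZ Q \<noteq> {} \<and> qZ Q \<subseteq> {..<2 ^ qm1 Q}
     \<and> (\<forall>i\<in>qZ Q. qtau Q i \<in> D) \<and> (\<forall>y. qbeta Q y < 2 ^ qm2 Q)"

text \<open>Basis index k of H_m = H_{m'} (x) H_{m''} (x) H_{m-m'-m''} decomposes as
  k = i * 2^(m-m') + x * 2^(m-m'-m'') + y (binary expansion, first register most significant).
  Q_f maps the basis state k to the basis state qf_perm Q f k.\<close>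
definition qf_perm :: "('d, 'k) qquery \<Rightarrow> ('d \<Rightarrow> 'k) \<Rightarrow> nat \<Rightarrow> nat" where
  "qf_perm Q f k =
     (let m = qm Q; m1 = qm1 Q; m2 = qm2 Q; r = m - m1 - m2;
          i = k div 2 ^ (m - m1); x = (k div 2 ^ r) mod 2 ^ m2; y = k mod 2 ^ r
      in if i \<in> qZ Q
         then i * 2 ^ (m - m1) + ((x + qbeta Q (f (qtau Q i))) mod 2 ^ m2) * 2 ^ r + y
         else k)"

definition qmat :: "('d, 'k) qquery \<Rightarrow> ('d \<Rightarrow> 'k) \<Rightarrow> cmat" where
  "qmat Q f a b = (if a = qf_perm Q f b then 1 else 0)"

definition mmul :: "nat \<Rightarrow> cmat \<Rightarrow> cmat \<Rightarrow> cmat" where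
  "mmul m M N a b = (\<Sum>j<2 ^ m. M a j * N j b)"

definition unitary_mat :: "nat \<Rightarrow> cmat \<Rightarrow> bool" where
  "unitary_mat m U \<longleftrightarrow> (\<forall>a b. a < 2 ^ m \<longrightarrow> b < 2 ^ m \<longrightarrow>
      (\<Sum>j<2 ^ m. cnj (U j a) * U j b) = (if a = b then 1 else 0))"

text \<open>Algorithm with no measurement (Q, [U_0,...,U_n]):
  A_f = U_n Q_f U_{n-1} ... U_1 Q_f U_0, using n = length Us - 1 queries.\<close>
definition alg_mat :: "('d, 'k) qquery \<Rightarrow> cmat list \<Rightarrow> ('d \<Rightarrow> 'k) \<Rightarrow> cmat" where
  "alg_mat Q Us f =
     foldl (\<lambda>acc U. mmul (qm Q) U (mmul (qm Q) (qmat Q f) acc)) (hd Us) (tl Us)"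

definition valid_nm :: "'d set \<Rightarrow> ('d, 'k) qquery \<Rightarrow> cmat list \<Rightarrow> bool" where
  "valid_nm D Q Us \<longleftrightarrow> valid_query D Q \<and> Us \<noteq> [] \<and> (\<forall>U\<in>set Us. unitary_mat (qm Q) U)"

text \<open>Algorithm with k measurements: a list of k components (Q_l, Us_l, b_l) and the
  output map phi. b_l gets the list of previous outcomes [x_0,...,x_{l-1}].\<close>
type_synonym ('d, 'k, 'g) qalg =
  "(('d, 'k) qquery \<times> cmat list \<times> (nat list \<Rightarrow> nat)) list \<times> (nat list \<Rightarrow> 'g)"

definition cQ :: "('d, 'k, 'g) qalg \<Rightarrow> nat \<Rightarrow> ('d, 'k) qquery" where
  "cQ A l = fst (fst A ! l)"
definition cU :: "('d, 'k, 'g) qalg \<Rightarrow> nat \<Rightarrow> cmat list" where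
  "cU A l = fst (snd (fst A ! l))"
definition cb :: "('d, 'k, 'g) qalg \<Rightarrow> nat \<Rightarrow> nat list \<Rightarrow> nat" where
  "cb A l = snd (snd (fst A ! l))"
definition nmeas :: "('d, 'k, 'g) qalg \<Rightarrow> nat" where
  "nmeas A = length (fst A)"
definition outmap :: "('d, 'k, 'g) qalg \<Rightarrow> nat list \<Rightarrow> 'g" where
  "outmap A = snd A"

definition valid_alg :: "'d set \<Rightarrow> ('d, 'k, 'g) qalg \<Rightarrow> bool" where
  "valid_alg D A \<longleftrightarrow> nmeas A \<ge> 1 \<and>
     (\<forall>l < nmeas A. valid_nm D (cQ A l) (cU A l) \<and>
        (\<forall>xs. length xs = l \<and> (\<forall>i<l. xs ! i < 2 ^ qm (cQ A i))
              \<longrightarrow> cb A l xs < 2 ^ qm (cQ A l)))"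

definition outcomes :: "('d, 'k, 'g) qalg \<Rightarrow> nat list set" where
  "outcomes A = {xs. length xs = nmeas A \<and> (\<forall>l<nmeas A. xs ! l < 2 ^ qm (cQ A l))}"

definition outprob :: "('d, 'k, 'g) qalg \<Rightarrow> ('d \<Rightarrow> 'k) \<Rightarrow> nat list \<Rightarrow> real" where
  "outprob A f xs = (\<Prod>l<nmeas A.
      (cmod (alg_mat (cQ A l) (cU A l) f (xs ! l) (cb A l (take l xs)))) ^ 2)"

definition nqueries :: "('d, 'k, 'g) qalg \<Rightarrow> nat" where
  "nqueries A = (\<Sum>l<nmeas A. length (cU A l) - 1)"

definition qerr :: "(('d \<Rightarrow> 'k) \<Rightarrow> 'g::real_normed_vector) \<Rightarrow> ('d, 'k, 'g) qalg
                    \<Rightarrow> ('d \<Rightarrow> 'k) \<Rightarrow> ereal" where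
  "qerr S A f = Inf {ereal eps | eps.
      (\<Sum>xs\<in>{xs\<in>outcomes A. norm (S f - outmap A xs) > eps}. outprob A f xs) \<le> 1/4}"

definition qerr_class :: "(('d \<Rightarrow> 'k) \<Rightarrow> 'g::real_normed_vector) \<Rightarrow> ('d, 'k, 'g) qalg
                          \<Rightarrow> ('d \<Rightarrow> 'k) set \<Rightarrow> ereal" where
  "qerr_class S A F = (SUP f\<in>F. qerr S A f)"

definition min_qerr :: "'d set \<Rightarrow> (('d \<Rightarrow> 'k) \<Rightarrow> 'g::real_normed_vector)
                        \<Rightarrow> ('d \<Rightarrow> 'k) set \<Rightarrow> nat \<Rightarrow> ereal" where
  "min_qerr D S F n = (INF A\<in>{A :: ('d, 'k, 'g) qalg. valid_alg D A \<and> nqueries A \<le> n}.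
                          qerr_class S A F)"

text \<open>Summation setting: functions Z[0,N) -> R represented as nat => real (values outside
  {..<N} are irrelevant).\<close>
definition LpN_norm :: "nat \<Rightarrow> real \<Rightarrow> (nat \<Rightarrow> real) \<Rightarrow> real" where
  "LpN_norm N p f = ((1 / real N) * (\<Sum>i<N. \<bar>f i\<bar> powr p)) powr (1 / p)"

definition BpN :: "nat \<Rightarrow> real \<Rightarrow> (nat \<Rightarrow> real) set" where
  "BpN N p = {f. LpN_norm N p f \<le> 1}"

definition SN :: "nat \<Rightarrow> (nat \<Rightarrow> real) \<Rightarrow> real" where
  "SN N f = (\<Sum>i<N. f i) / real N"

end

theory Submission
  imports Defs
begin

text \<open>Write the positive and the negative part of \<open>f\<close> in binary.  The bit of weight \<open>w\<close> is set at a
  fraction \<open>a \<le> w powr (-p)\<close> of the indices, and amplitude estimation with \<open>T\<close> Grover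
  iterations finds \<open>a\<close> up to \<open>O(d sqrt a / T + d\<^sup>2 / T\<^sup>2)\<close> except with probability \<open>2 / d\<close>.  Let
  \<open>M\<close> be of order \<open>(N / n) powr (2 / p)\<close>.  Spending \<open>n\<close> queries times a factor that decays
  geometrically in the distance of \<open>w\<close> from \<open>M\<close>, the error for \<open>w \<ge> M\<close> is below
  \<open>1 / N\<close>, so rounding to a multiple of \<open>1 / N\<close> makes those counts exact (no search for the
  large entries is needed), while for \<open>w < M\<close> the errors \<open>w powr (1 - p / 2) / n\<close> form a
  geometric series because \<open>p < 2\<close>.  The resulting bound does not even need the logarithm.\<close>

section \<open>Block matrices, reflections and the Fourier transform\<close>

text \<open>The obstacle is the term \<open>w * sqrt a / T\<close>: with \<open>a\<close> near
  \<open>w powr (-p)\<close> it grows with \<open>w\<close>, so the weights near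
  \<open>N powr (1 / p)\<close> would spoil the rate if each level merely kept a proportional error.
  A frequency is a multiple of \<open>1 / N\<close>, however, so an error below that spacing
  vanishes after rounding. \<open>M\<close> is the weight at which
  \<open>w powr (- p / 2) / n\<close> has sunk to order \<open>1 / N\<close>: the levels above
  contribute nothing, and level \<open>M\<close> itself contributes
  \<open>M powr (1 - p / 2) / n\<close>, which is of the order of the target
  \<open>n powr (- 2 / p) * N powr (2 / p - 1)\<close>. The assumption on \<open>n / sqrt N\<close>
  controls the quadratic term \<open>d^2 / T^2\<close>. Failure probabilities have to be summable as
  well as queries, so \<open>T\<close> and \<open>1 / d\<close> are both scaled by the same
  geometric factor, and \<open>d / T\<close> grows like its inverse square. The ratio
  \<open>2 powr (- (2 - p) / 8)\<close> is close enough to 1 for this growth to stay below the decay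
  of \<open>w powr (1 - p / 2)\<close> underneath \<open>M\<close>.\<close>

lemma sum_div_mod:
  fixes g :: "nat \<Rightarrow> 'a::comm_monoid_add"
  shows "(\<Sum>k<J * T. g k) = (\<Sum>j<J. \<Sum>y<T. g (j * T + y))"
proof -
  have "(\<Sum>k<J * T. g k) = (\<Sum>j<J. sum g {j * T..<j * T + T})"
    by (rule sum.nat_group[symmetric])
  also have "\<dots> = (\<Sum>j<J. \<Sum>y<T. g (j * T + y))"
  proof (rule sum.cong[OF refl])
    fix j
    show "sum g {j * T..<j * T + T} = (\<Sum>y<T. g (j * T + y))"
      using sum.shift_bounds_nat_ivl[of g 0 "j*T" T]
      by (simp add: atLeast0LessThan add.commute)
  qed
  finally show ?thesis .
qed

section \<open>Unitary matrices and circuits without measurement\<close>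

lemma unitary_mat_mmul:
  assumes "unitary_mat m U" "unitary_mat m V"
  shows "unitary_mat m (mmul m U V)"
  unfolding unitary_mat_def
proof (intro allI impI)
  fix a b :: nat assume ab: "a < 2 ^ m" "b < 2 ^ m"
  have "(\<Sum>j<2 ^ m. cnj (mmul m U V j a) * mmul m U V j b)
      = (\<Sum>j<2 ^ m. \<Sum>k<2 ^ m. \<Sum>l<2 ^ m. (cnj (V k a) * V l b) * (cnj (U j k) * U j l))"
    unfolding mmul_def cnj_sum sum_product by (simp add: mult_ac)
  also have "\<dots> = (\<Sum>k<2 ^ m. \<Sum>l<2 ^ m. (cnj (V k a) * V l b) * (\<Sum>j<2 ^ m. cnj (U j k) * U j l))"
    unfolding sum_distrib_left
    by (rule trans[OF sum.swap], rule sum.cong[OF refl], rule sum.swap)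
  also have "\<dots> = (\<Sum>k<2 ^ m. \<Sum>l<2 ^ m. (cnj (V k a) * V l b) * (if k = l then 1 else 0))"
    using assms(1) unfolding unitary_mat_def by (intro sum.cong refl) auto
  also have "\<dots> = (\<Sum>k<2 ^ m. cnj (V k a) * V k b)"
    by (intro sum.cong refl) (simp add: if_distrib[of "(*) _"] cong: if_cong)
  also have "\<dots> = (if a = b then 1 else 0)"
    using assms(2) ab unfolding unitary_mat_def by auto
  finally show "(\<Sum>j<2 ^ m. cnj (mmul m U V j a) * mmul m U V j b) = (if a = b then 1 else 0)" .
qed

lemma mmul_assoc: "mmul m (mmul m U V) W = mmul m U (mmul m V W)"
proof (intro ext)
  fix a b
  have "mmul m (mmul m U V) W a b = (\<Sum>j<2 ^ m. \<Sum>k<2 ^ m. U a k * V k j * W j b)"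
    by (simp add: mmul_def sum_distrib_right)
  also have "\<dots> = (\<Sum>k<2 ^ m. \<Sum>j<2 ^ m. U a k * V k j * W j b)"
    by (rule sum.swap)
  also have "\<dots> = mmul m U (mmul m V W) a b"
    by (simp add: mmul_def sum_distrib_left mult.assoc)
  finally show "mmul m (mmul m U V) W a b = mmul m U (mmul m V W) a b" .
qed

lemma alg_mat_snoc:
  assumes "Us \<noteq> []"
  shows "alg_mat Q (Us @ [U]) f = mmul (qm Q) U (mmul (qm Q) (qmat Q f) (alg_mat Q Us f))"
  using assms by (simp add: alg_mat_def)

text \<open>A unitary applied after the last query is absorbed into the last matrix, so the Fourier
  transform at the end of the circuit costs no query.\<close>

lemma alg_mat_post:
  assumes "Us \<noteq> []"
  shows "alg_mat Q (butlast Us @ [mmul (qm Q) F (last Us)]) f = mmul (qm Q) F (alg_mat Q Us f)"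
proof (cases "butlast Us = []")
  case True
  then obtain U where "Us = [U]"
    using assms by (metis append_butlast_last_id append_Nil)
  then show ?thesis by (simp add: alg_mat_def)
next
  case False
  have "alg_mat Q Us f = alg_mat Q (butlast Us @ [last Us]) f" using assms by simp
  also have "\<dots> = mmul (qm Q) (last Us) (mmul (qm Q) (qmat Q f) (alg_mat Q (butlast Us) f))"
    using False by (rule alg_mat_snoc)
  finally show ?thesis using False by (simp add: alg_mat_snoc mmul_assoc)
qed

lemma unitary_alg_mat:
  assumes "Us \<noteq> []" "\<forall>U\<in>set Us. unitary_mat (qm Q) U" "unitary_mat (qm Q) (qmat Q f)"
  shows "unitary_mat (qm Q) (alg_mat Q Us f)"
  using assms(1,2)
proof (induction Us rule: rev_induct)
  case (snoc U Us)
  show ?case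
  proof (cases "Us = []")
    case True
    then show ?thesis using snoc.prems by (simp add: alg_mat_def)
  next
    case False
    then show ?thesis
      using snoc assms(3) by (simp add: alg_mat_snoc unitary_mat_mmul)
  qed
qed simp

lemma unitary_mat_column:
  assumes "unitary_mat m U" "b < 2 ^ m"
  shows "(\<Sum>a<2 ^ m. (cmod (U a b))\<^sup>2) = 1"
proof -
  have "complex_of_real (\<Sum>a<2 ^ m. (cmod (U a b))\<^sup>2) = (\<Sum>a<2 ^ m. cnj (U a b) * U a b)"
    unfolding of_real_sum
    by (intro sum.cong refl) (metis complex_norm_square mult.commute)
  also have "\<dots> = 1" using assms unfolding unitary_mat_def by auto
  finally show ?thesis using of_real_eq_1_iff by blast
qed

section \<open>Real reflections and state preparation\<close>

definition hrefl :: "(nat \<Rightarrow> real) \<Rightarrow> real \<Rightarrow> cmat" where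
  "hrefl u c a b = of_real ((if a = b then 1 else 0) - u a * u b / c)"

text \<open>With \<open>c\<close> equal to half the squared norm of \<open>u\<close>, the matrix is
  the Householder reflection in the hyperplane orthogonal to \<open>u\<close>; keeping
  \<open>c\<close> as a parameter avoids normalising \<open>u\<close>.\<close>

lemma unitary_hrefl:
  assumes "(\<Sum>a<2 ^ m. (u a)\<^sup>2) = 2 * c" "c \<noteq> 0"
  shows "unitary_mat m (hrefl u c)"
  unfolding unitary_mat_def
proof (intro allI impI)
  fix a b :: nat assume ab: "a < 2 ^ m" "b < 2 ^ m"
  have *: "((if j = a then 1 else 0) - u j * u a / c) * ((if j = b then 1 else 0) - u j * u b / c)
     = (if j = a then (if a = b then 1 else 0) else 0) - (if j = a then u j * u b / c else 0)
       - (if j = b then u j * u a / c else 0) + (u a * u b / c\<^sup>2) * (u j)\<^sup>2" for j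
    using assms(2) by (auto simp: field_simps power2_eq_square)
  have "(\<Sum>j<2 ^ m. ((if j = a then 1 else 0) - u j * u a / c) * ((if j = b then 1 else 0) - u j * u b / c))
     = (if a = b then 1 else 0) - u a * u b / c - u b * u a / c + (u a * u b / c\<^sup>2) * (2 * c)"
    unfolding * sum.distrib sum_subtractf sum_distrib_left[symmetric] assms(1) using ab by simp
  also have "\<dots> = (if a = b then 1 else 0)"
    using assms(2) by (simp add: field_simps power2_eq_square)
  finally have **: "(\<Sum>j<2 ^ m. ((if j = a then 1 else 0) - u j * u a / c) * ((if j = b then 1 else 0) - u j * u b / c))
    = (if a = b then 1 else 0)" .
  have "(\<Sum>j<2 ^ m. cnj (hrefl u c j a) * hrefl u c j b) = of_real (\<Sum>j<2 ^ m. ((if j = a then 1 else 0) - u j * u a / c) * ((if j = b then 1 else 0) - u j * u b / c))"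
    unfolding hrefl_def by simp
  then show "(\<Sum>j<2 ^ m. cnj (hrefl u c j a) * hrefl u c j b) = (if a = b then 1 else 0)"
    unfolding ** by simp
qed

lemma hrefl_apply:
  assumes "i < n"
  shows "(\<Sum>j<n. hrefl u c i j * of_real (v j)) = of_real (v i - u i / c * (\<Sum>j<n. u j * v j))"
proof -
  have "(\<Sum>j<n. hrefl u c i j * of_real (v j))
      = of_real (\<Sum>j<n. (if j = i then v j else 0) - u i / c * (u j * v j))"
    unfolding of_real_sum by (intro sum.cong refl) (auto simp: hrefl_def algebra_simps)
  then show ?thesis
    using assms by (simp add: sum_subtractf sum_distrib_left)
qed

text \<open>The Householder reflection that maps \<open>e\<^sub>0\<close> to the real unit vector \<open>v\<close>.\<close>

definition prep_mat :: "(nat \<Rightarrow> real) \<Rightarrow> cmat" where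
  "prep_mat v = hrefl (\<lambda>a. v a - (if a = 0 then 1 else 0)) (1 - v 0)"

text \<open>A unit vector with \<open>v 0 = 1\<close> is the basis vector at 0 itself; the axis of
  the reflection then vanishes, and the formula divides by zero.\<close>

lemma prep_mat_column: "v 0 \<noteq> 1 \<Longrightarrow> prep_mat v a 0 = of_real (v a)"
  by (simp add: prep_mat_def hrefl_def divide_simps) (simp add: algebra_simps)

lemma unitary_prep_mat:
  assumes "(\<Sum>a<2 ^ m. (v a)\<^sup>2) = 1" "v 0 \<noteq> 1"
  shows "unitary_mat m (prep_mat v)"
  unfolding prep_mat_def
proof (rule unitary_hrefl)
  have *: "(v a - (if a = 0 then 1 else 0))\<^sup>2 = (v a)\<^sup>2 + (if a = 0 then 1 - 2 * v 0 else 0)" for a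
    by (simp add: power2_eq_square algebra_simps)
  show "(\<Sum>a<2 ^ m. (v a - (if a = 0 then 1 else 0))\<^sup>2) = 2 * (1 - v 0)"
    unfolding * sum.distrib assms(1) by simp
qed (use assms in simp)

section \<open>Matrices acting on one factor of the index \<open>j * T + y\<close>\<close>

definition on_high :: "nat \<Rightarrow> (nat \<Rightarrow> cmat) \<Rightarrow> cmat" where
  "on_high T V a b = (if a mod T = b mod T then V (a mod T) (a div T) (b div T) else 0)"

definition on_low :: "nat \<Rightarrow> cmat \<Rightarrow> cmat" where
  "on_low T V a b = (if a div T = b div T then V (a mod T) (b mod T) else 0)"

lemma on_high_apply:
  assumes "T > 0"
  shows "(\<Sum>k<J * T. on_high T V a k * v k) = (\<Sum>j<J. V (a mod T) (a div T) j * v (j * T + a mod T))"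
proof -
  have "(\<Sum>k<J * T. on_high T V a k * v k)
      = (\<Sum>j<J. \<Sum>y<T. if y = a mod T then V (a mod T) (a div T) j * v (j * T + y) else 0)"
    unfolding sum_div_mod by (intro sum.cong refl) (auto simp: on_high_def)
  then show ?thesis using assms by simp
qed

lemma on_low_apply:
  assumes "a < J * T"
  shows "(\<Sum>k<J * T. on_low T V a k * v k) = (\<Sum>y<T. V (a mod T) y * v (a div T * T + y))"
proof -
  have "T > 0" using assms by (cases T) auto
  have "(\<Sum>k<J * T. on_low T V a k * v k)
      = (\<Sum>j<J. if j = a div T then (\<Sum>y<T. V (a mod T) y * v (j * T + y)) else 0)"
    unfolding sum_div_mod by (intro sum.cong refl) (auto simp: on_low_def \<open>T > 0\<close>)
  then show ?thesis using assms by (simp add: less_mult_imp_div_less)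
qed

lemma div_mod_eq_iff: "(a::nat) div T = b div T \<and> a mod T = b mod T \<longleftrightarrow> a = b"
  by (metis div_mult_mod_eq)

lemma unitary_on_high:
  assumes "\<And>y. y < 2 ^ t \<Longrightarrow> unitary_mat m (V y)"
  shows "unitary_mat (m + t) (on_high (2 ^ t) V)"
  unfolding unitary_mat_def
proof (intro allI impI)
  let ?T = "2 ^ t :: nat"
  fix a b :: nat assume ab: "a < 2 ^ (m + t)" "b < 2 ^ (m + t)"
  then have ab': "a div ?T < 2 ^ m" "b div ?T < 2 ^ m"
    by (simp_all add: power_add less_mult_imp_div_less)
  have cnj: "cnj (on_high ?T V j a) = on_high ?T (\<lambda>y c d. cnj (V y d c)) a j" for j
    by (simp add: on_high_def)
  have "(\<Sum>j<2 ^ (m + t). cnj (on_high ?T V j a) * on_high ?T V j b)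
      = (\<Sum>j<2 ^ m. cnj (V (a mod ?T) j (a div ?T)) * on_high ?T V (j * ?T + a mod ?T) b)"
    unfolding cnj power_add by (rule on_high_apply) simp
  also have "\<dots> = (if a mod ?T = b mod ?T then
      (\<Sum>j<2 ^ m. cnj (V (a mod ?T) j (a div ?T)) * V (a mod ?T) j (b div ?T)) else 0)"
    by (auto simp: on_high_def)
  also have "\<dots> = (if a mod ?T = b mod ?T then if a div ?T = b div ?T then 1 else 0 else 0)"
    using assms[of "a mod ?T"] ab' unfolding unitary_mat_def by force
  also have "\<dots> = (if a = b then 1 else 0)"
    using div_mod_eq_iff[of a ?T b] by auto
  finally show "(\<Sum>j<2 ^ (m + t). cnj (on_high ?T V j a) * on_high ?T V j b) = (if a = b then 1 else 0)" .
qed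

lemma unitary_on_low:
  assumes "unitary_mat t V"
  shows "unitary_mat (m + t) (on_low (2 ^ t) V)"
  unfolding unitary_mat_def
proof (intro allI impI)
  let ?T = "2 ^ t :: nat"
  fix a b :: nat assume ab: "a < 2 ^ (m + t)" "b < 2 ^ (m + t)"
  have cnj: "cnj (on_low ?T V j a) = on_low ?T (\<lambda>c d. cnj (V d c)) a j" for j
    by (simp add: on_low_def)
  have "(\<Sum>j<2 ^ (m + t). cnj (on_low ?T V j a) * on_low ?T V j b)
      = (\<Sum>y<?T. cnj (V y (a mod ?T)) * on_low ?T V (a div ?T * ?T + y) b)"
    unfolding cnj power_add by (rule on_low_apply) (use ab in \<open>simp add: power_add\<close>)
  also have "\<dots> = (if a div ?T = b div ?T then
      (\<Sum>y<?T. cnj (V y (a mod ?T)) * V y (b mod ?T)) else 0)"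
    by (auto simp: on_low_def)
  also have "\<dots> = (if a div ?T = b div ?T then if a mod ?T = b mod ?T then 1 else 0 else 0)"
    using assms unfolding unitary_mat_def by simp
  also have "\<dots> = (if a = b then 1 else 0)"
    using div_mod_eq_iff[of a ?T b] by auto
  finally show "(\<Sum>j<2 ^ (m + t). cnj (on_low ?T V j a) * on_low ?T V j b) = (if a = b then 1 else 0)" .
qed

section \<open>Exponential sums and the Fourier transform\<close>

lemma geometric_cis_bound: "cmod (\<Sum>k<n. cis (real k * x)) * \<bar>sin (x / 2)\<bar> \<le> 1"
proof -
  have *: "cis (real k * x) = cis x ^ k" for k by (rule Complex.DeMoivre[symmetric])
  \<comment> \<open>The telescoped identity is kept as a product, so multiples of
    \<open>2 * pi\<close> need no exception.\<close>
  have "(cis x - 1) * (\<Sum>k<n. cis (real k * x)) = cis x ^ n - 1"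
    unfolding * by (rule power_diff_1_eq[symmetric])
  then have "cmod (cis x - 1) * cmod (\<Sum>k<n. cis (real k * x)) = cmod (cis x ^ n - 1)"
    by (metis norm_mult)
  also have "\<dots> \<le> 2"
    by (rule order.trans[OF norm_triangle_ineq4]) (simp add: norm_power)
  also have "cmod (cis x - 1) = 2 * \<bar>sin (x / 2)\<bar>"
  proof -
    have "cis x = cis (x/2) * cis (x/2)" by (simp add: cis_mult)
    then have "cis x - 1 = cis (x/2) * (cis (x/2) - cis (-(x/2)))"
      by (simp add: algebra_simps cis_mult)
    also have "cis (x/2) - cis (-(x/2)) = 2 * \<i> * sin (x/2)"
      by (simp add: complex_eq_iff)
    finally show ?thesis by (simp add: norm_mult)
  qed
  finally show ?thesis by (simp add: mult.commute)
qed

definition dft_mat :: "nat \<Rightarrow> cmat" where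
  "dft_mat T a b = cis (- (2 * pi * real a * real b / real T)) / of_real (sqrt (real T))"

text \<open>The inner product of two columns is a geometric sum of a \<open>T\<close>-th root of
  unity \<open>z\<close>; as both column numbers lie below \<open>T\<close>, \<open>z = 1\<close>
  happens only on the diagonal.\<close>

lemma unitary_dft_mat: "unitary_mat t (dft_mat (2 ^ t))"
  unfolding unitary_mat_def
proof (intro allI impI)
  let ?T = "2 ^ t :: nat"
  fix a b :: nat assume ab: "a < 2 ^ t" "b < 2 ^ t"
  define z where "z = cis (2 * pi * (real a - real b) / real ?T)"
  have T: "real ?T > 0" by simp
  have sq: "complex_of_real (sqrt (real ?T)) * of_real (sqrt (real ?T)) = of_nat ?T"
    by (metis of_real_mult of_real_of_nat_eq real_sqrt_mult_self abs_of_nat)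
  have *: "cnj (dft_mat ?T j a) * dft_mat ?T j b = z ^ j / of_nat ?T" for j
    unfolding dft_mat_def z_def Complex.DeMoivre complex_cnj_divide complex_cnj_complex_of_real times_divide_times_eq sq cis_cnj cis_mult
    by (intro arg_cong2[of _ _ _ _ "(/)"] arg_cong[of _ _ cis] refl) (simp add: field_simps)
  have "z ^ ?T = 1"
  proof -
    have "z ^ ?T = cis (2 * pi * of_int (int a - int b))"
      unfolding z_def Complex.DeMoivre using T by simp
    then show ?thesis by (simp only: cis_multiple_2pi Ints_of_int)
  qed
  moreover have "z = 1 \<longleftrightarrow> a = b"
  proof
    assume "z = 1"
    then obtain k :: int where "2 * pi * (real a - real b) / real ?T = real_of_int (2 * k) * pi"
      unfolding z_def by (auto simp: complex_eq_iff cos_one_2pi_int)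
    then have "(real a - real b) * (2 * pi) = (of_int k * real ?T) * (2 * pi)"
      by (simp add: field_simps)
    then have "real a - real b = of_int k * real ?T"
      unfolding mult_cancel_right by simp
    then have "real_of_int (int a - int b) = real_of_int (k * int ?T)" by simp
    then have "int a - int b = k * int ?T" unfolding of_int_eq_iff .
    moreover have "int a < int ?T" "int b < int ?T" using ab by simp_all
    ultimately have "k * int ?T < 1 * int ?T" "- 1 * int ?T < k * int ?T" by linarith+
    then have "k < 1" "- 1 < k" unfolding mult_less_cancel_right by auto
    then have "k = 0" by simp
    then show "a = b" using \<open>int a - int b = k * int ?T\<close> by simp
  qed (simp add: z_def)
  ultimately have "(\<Sum>j<?T. z ^ j) = (if a = b then of_nat ?T else 0)"
    using geometric_sum[of z ?T] by auto
  then show "(\<Sum>j<?T. cnj (dft_mat ?T j a) * dft_mat ?T j b) = (if a = b then 1 else 0)"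
    unfolding * sum_divide_distrib[symmetric] by simp
qed

text \<open>A Grover step in plane coordinates: (sin x, cos x) has its first coordinate negated and
  is then reflected along (sin a, cos a), with \<open>m\<close> the inner product of the two
  vectors. The effect is a rotation by \<open>2 * a\<close> and a global sign, which disappears when
  steps come in pairs.\<close>

lemma rotation_step:
  fixes x a :: real
  defines "m \<equiv> cos x * cos a - sin x * sin a"
  shows "- sin x - 2 * m * sin a = - sin (x + 2 * a)" "cos x - 2 * m * cos a = - cos (x + 2 * a)"
proof -
  have m: "m = cos (x + a)" by (simp add: m_def cos_add)
  have "x + 2 * a = (x + a) + a" by simp
  then have 1: "sin (x + 2 * a) = sin (x + a) * cos a + cos (x + a) * sin a"
    "cos (x + 2 * a) = cos (x + a) * cos a - sin (x + a) * sin a"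
    by (metis sin_add, metis cos_add)
  have "sin x = sin ((x + a) - a)" "cos x = cos ((x + a) - a)" by simp_all
  then have 2: "sin x = sin (x + a) * cos a - cos (x + a) * sin a"
    "cos x = cos (x + a) * cos a + sin (x + a) * sin a"
    by (metis sin_diff, metis cos_diff)
  show "- sin x - 2 * m * sin a = - sin (x + 2 * a)" "cos x - 2 * m * cos a = - cos (x + 2 * a)"
    unfolding m 1 by (subst 2, simp)+
qed

section \<open>Estimates for sines and inverse squares\<close>

lemma abs_sin_ge:
  assumes "\<bar>x\<bar> \<le> pi / 2"
  shows "2 / pi * \<bar>x\<bar> \<le> \<bar>sin x\<bar>"
proof -
  \<comment> \<open>Jordan's inequality: the chord of the concave sine over this interval has slope
    2 / pi.\<close>
  have conc: "concave_on {0..pi / 2} (sin :: real \<Rightarrow> real)"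
  proof (rule f''_le0_imp_concave)
    show "DERIV sin x :> cos x" "DERIV cos x :> - sin x" for x :: real
      by (auto intro!: derivative_eq_intros)
    show "- sin x \<le> 0" if "x \<in> {0..pi / 2}" for x :: real
      using that sin_ge_zero[of x] pi_gt_zero by (auto simp: field_simps)
  qed simp
  have pos: "2 / pi * y \<le> sin y" if "0 \<le> y" "y \<le> pi / 2" for y :: real
  proof -
    have "(1 - 2 * y / pi) * sin 0 + (2 * y / pi) * sin (pi / 2)
        \<le> sin ((1 - 2 * y / pi) *\<^sub>R 0 + (2 * y / pi) *\<^sub>R (pi / 2))"
      using that by (intro concave_onD[OF conc]) (auto simp: field_simps)
    then show ?thesis by simp
  qed
  show ?thesis
  proof (cases "x \<ge> 0")
    case True
    then show ?thesis using pos[of x] assms by simp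
  next
    case False
    then show ?thesis using pos[of "- x"] assms by simp
  qed
qed

text \<open>Used to compare the two resonances of the Fourier transform: the mirrored one is never
  closer than the direct one.\<close>

lemma sin_add_ge_abs_sin_diff:
  assumes "0 \<le> x" "x \<le> pi / 2" "0 \<le> y" "y \<le> pi / 2"
  shows "\<bar>sin (x - y)\<bar> \<le> sin (x + y)"
proof -
  have "0 \<le> sin x * cos y" "0 \<le> cos x * sin y"
    using assms by (auto intro!: mult_nonneg_nonneg sin_ge_zero cos_ge_zero)
  then show ?thesis by (auto simp: sin_add sin_diff abs_le_iff)
qed

lemma sum_inverse_square_tail:
  fixes \<kappa> d :: real
  assumes "d \<ge> 2"
  shows "(\<Sum>v<n. if \<bar>real v - \<kappa>\<bar> > d then 1 / (real v - \<kappa>)\<^sup>2 else 0) \<le> 4 / d"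
proof -
  \<comment> \<open>A truncated reciprocal: \<open>1 / x^2\<close> is at most
    \<open>1 / (x - 1) - 1 / x\<close> beyond \<open>d\<close>, and freezing the value below
    \<open>d - 1\<close> keeps the differences nonnegative elsewhere. The sum then telescopes over
    all \<open>v\<close> at once, whatever the position of \<open>\<kappa>\<close>.\<close>
  define G where "G x = 1 / max (d - 1) x" for x :: real
  have G: "0 \<le> G x" "G x \<le> 1 / (d - 1)" for x
    using assms by (auto simp: G_def intro!: frac_le)
  have tele: "(if x > d then 1 / x\<^sup>2 else 0) \<le> G (x - 1) - G x" for x
  proof (cases "x > d")
    case True
    then have "1 / x\<^sup>2 \<le> 1 / ((x - 1) * x)"
      using assms unfolding power2_eq_square by (intro frac_le mult_right_mono) auto
    also have "\<dots> = 1 / (x - 1) - 1 / x" using True assms by (simp add: field_simps)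
    finally show ?thesis using True assms by (simp add: G_def max_def)
  next
    case False
    have "G x \<le> G (x - 1)" using assms unfolding G_def by (intro frac_le) auto
    then show ?thesis using False by simp
  qed
  have "(\<Sum>v<n. if \<bar>real v - \<kappa>\<bar> > d then 1 / (real v - \<kappa>)\<^sup>2 else 0)
     \<le> (\<Sum>v<n. (G (real v - \<kappa> - 1) - G (real v - \<kappa>)) + (G (\<kappa> - real v - 1) - G (\<kappa> - real v)))"
  proof (rule sum_mono)
    fix v
    have "(if \<bar>real v - \<kappa>\<bar> > d then 1 / (real v - \<kappa>)\<^sup>2 else 0)
       = (if real v - \<kappa> > d then 1 / (real v - \<kappa>)\<^sup>2 else 0) + (if \<kappa> - real v > d then 1 / (\<kappa> - real v)\<^sup>2 else 0)"
      using assms by (auto simp: power2_commute)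
    then show "(if \<bar>real v - \<kappa>\<bar> > d then 1 / (real v - \<kappa>)\<^sup>2 else 0)
       \<le> (G (real v - \<kappa> - 1) - G (real v - \<kappa>)) + (G (\<kappa> - real v - 1) - G (\<kappa> - real v))"
      using tele[of "real v - \<kappa>"] tele[of "\<kappa> - real v"] by linarith
  qed
  also have "\<dots> = (G (- \<kappa> - 1) - G (real n - \<kappa> - 1)) + (G (\<kappa> - real n) - G \<kappa>)"
    by (induction n) (simp_all add: algebra_simps)
  also have "\<dots> \<le> 2 / (d - 1)"
    using G[of "- \<kappa> - 1"] G[of "real n - \<kappa> - 1"] G[of "\<kappa> - real n"] G[of \<kappa>] by simp
  also have "\<dots> \<le> 4 / d" using assms by (simp add: field_simps)
  finally show ?thesis .
qed

section \<open>Amplitude estimation of a frequency\<close>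

locale counting =
  fixes N t :: nat and chi :: "real \<Rightarrow> bool"
  assumes N_pos: "N \<ge> 1"
begin

abbreviation "T \<equiv> (2::nat) ^ t"

text \<open>Only queries are counted, not qubits, so the argument register simply gets
  \<open>N\<close> qubits; this leaves room for \<open>2 * N\<close> arguments, of which the upper
  half lies outside \<open>qZ\<close>.\<close>

definition query :: "(nat, real) qquery" where
  "query = \<lparr>qm = N + 1 + t, qm1 = N, qm2 = 1, qZ = {..<N}, qtau = id,
     qbeta = (\<lambda>v. if chi v then 1 else 0)\<rparr>"

lemma query_simps [simp]:
  "qm query = N + 1 + t" "qm1 query = N" "qm2 query = 1" "qZ query = {..<N}"
  "qtau query = id" "qbeta query = (\<lambda>v. if chi v then 1 else 0)"
  by (simp_all add: query_def)

lemma dim_eq: "(2::nat) ^ (N + 1 + t) = 2 ^ (N + 1) * T"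
  by (rule power_add)

lemma four_N_le: "4 * N \<le> 2 ^ (N + 1)"
proof -
  have "2 * N \<le> 2 ^ N"
    using N_pos by (induction N rule: dec_induct) auto
  then show ?thesis by simp
qed

lemma valid_query: "valid_query {..<N} query"
proof -
  have "0 < N" using N_pos by simp
  then have "{..<N} \<noteq> {}" by blast
  moreover have "{..<N} \<subseteq> {..<2 ^ N}" using less_exp[of N] by (simp add: less_imp_le)
  ultimately show ?thesis using \<open>0 < N\<close> by (simp add: valid_query_def)
qed

definition good :: "(nat \<Rightarrow> real) \<Rightarrow> nat \<Rightarrow> bool" where
  "good f j \<longleftrightarrow> j div 2 < N \<and> chi (f (j div 2))"

definition flip :: "nat \<Rightarrow> nat" where
  "flip j = (if even j then j + 1 else j - 1)"

lemma flip_div2 [simp]: "flip j div 2 = j div 2"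
  by (auto simp: flip_def elim!: oddE)

lemma good_flip [simp]: "good f (flip j) = good f j"
  by (simp add: good_def)

lemma flip_flip [simp]: "flip (flip j) = j"
  by (auto simp: flip_def)

lemma flip_less: "j < 2 ^ (N + 1) \<Longrightarrow> flip j < 2 ^ (N + 1)"
proof -
  assume "j < 2 ^ (N + 1)"
  then have "j div 2 < 2 ^ N" by simp
  then have "flip j div 2 < 2 ^ N" by simp
  moreover have "a div 2 < b \<Longrightarrow> a < 2 * b" for a b :: nat by linarith
  ultimately show ?thesis by (simp del: flip_div2)
qed

text \<open>On a single answer bit, addition modulo 2 is a flip. Arguments with false
  \<open>chi\<close> add 0 and thus behave like arguments outside \<open>qZ\<close>.\<close>

lemma qf_perm_query:
  "qf_perm query f k = (if good f (k div T) then flip (k div T) * T + k mod T else k)"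
proof -
  have 1: "N + 1 + t - N = 1 + t" "N + 1 + t - N - 1 = t" by simp_all
  have 2: "k div 2 ^ (1 + t) = k div T div 2"
    by (metis div_mult2_eq mult.commute power_Suc plus_1_eq_Suc)
  have 3: "flip j = j div 2 * 2 + (j mod 2 + 1) mod 2" for j
    by (cases "even j") (auto simp: flip_def elim!: oddE evenE)
  have 4: "k div T div 2 * 2 ^ (1 + t) + (k div T) mod 2 * T + k mod T = k"
  proof -
    have "k div T div 2 * 2 ^ (1 + t) + (k div T) mod 2 * T = (k div T) * T"
      by (metis (no_types, lifting) add_mult_distrib div_mult_mod_eq mult.assoc power_add power_one_right)
    then show ?thesis by (simp add: div_mult_mod_eq)
  qed
  show ?thesis
    unfolding qf_perm_def Let_def query_simps 1 2 good_def id_apply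
    using 4 by (auto simp: 3 add_mult_distrib)
qed

lemma qf_perm_less: "k < 2 ^ (N + 1 + t) \<Longrightarrow> qf_perm query f k < 2 ^ (N + 1 + t)"
proof -
  assume k: "k < 2 ^ (N + 1 + t)"
  then have "flip (k div T) < 2 ^ (N + 1)"
    using flip_less unfolding dim_eq by (simp add: less_mult_imp_div_less)
  then have "(flip (k div T) + 1) * T \<le> 2 ^ (N + 1) * T"
    by (intro mult_right_mono) auto
  moreover have "flip (k div T) * T + k mod T < (flip (k div T) + 1) * T" by simp
  ultimately have "flip (k div T) * T + k mod T < 2 ^ (N + 1) * T" by linarith
  then show ?thesis using k unfolding qf_perm_query dim_eq by simp
qed

lemma qf_perm_invol: "qf_perm query f (qf_perm query f k) = k"
  by (simp add: qf_perm_query div_mult_mod_eq)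

lemma unitary_qmat: "unitary_mat (qm query) (qmat query f)"
  unfolding unitary_mat_def
proof (intro allI impI)
  fix a b :: nat assume ab: "a < 2 ^ qm query" "b < 2 ^ qm query"
  have "(\<Sum>j<2 ^ qm query. cnj (qmat query f j a) * qmat query f j b)
     = (\<Sum>j<2 ^ qm query. if j = qf_perm query f a then
          (if qf_perm query f a = qf_perm query f b then 1 else 0) else 0)"
    by (intro sum.cong refl) (auto simp: qmat_def)
  also have "\<dots> = (if qf_perm query f a = qf_perm query f b then 1 else 0)"
    using qf_perm_less[of a f] ab by simp
  also have "qf_perm query f a = qf_perm query f b \<longleftrightarrow> a = b"
    by (metis qf_perm_invol)
  finally show "(\<Sum>j<2 ^ qm query. cnj (qmat query f j a) * qmat query f j b) = (if a = b then 1 else 0)" .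
qed

lemma mmul_qmat:
  assumes "k < 2 ^ (N + 1 + t)"
  shows "mmul (N + 1 + t) (qmat query f) V k b = V (qf_perm query f k) b"
proof -
  have "mmul (N + 1 + t) (qmat query f) V k b
      = (\<Sum>j<2 ^ (N + 1 + t). if j = qf_perm query f k then V j b else 0)"
    unfolding mmul_def
    by (intro sum.cong refl) (auto simp: qmat_def qf_perm_invol)
  then show ?thesis using qf_perm_less[OF assms] by simp
qed

text \<open>A basis index is \<open>(2 * i + x) * T + y\<close> with argument \<open>i\<close>, query bit \<open>x\<close> and counter \<open>y\<close>.
  In \<open>psi\<close> the query bit is in the state \<open>(1, -1) / sqrt 2\<close>, which turns a query into a sign.  The
  arguments run up to \<open>2 * N\<close> so that the good amplitude is at most \<open>1 / sqrt 2\<close>: the circuit uses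
  squares of Grover iterations, which do not distinguish \<open>theta\<close> from \<open>pi / 2 - theta\<close>.\<close>

definition psi :: "nat \<Rightarrow> real" where
  "psi j = (if j < 4 * N then (if even j then 1 else - 1) / sqrt (4 * real N) else 0)"

section \<open>The frequency as an angle and the Grover plane\<close>

definition freq :: "(nat \<Rightarrow> real) \<Rightarrow> real" where
  "freq f = real (card {i. i < N \<and> chi (f i)}) / real N"

lemma freq_bounds: "0 \<le> freq f" "freq f \<le> 1"
proof -
  have "card {i. i < N \<and> chi (f i)} \<le> card {..<N}" by (intro card_mono) auto
  then show "0 \<le> freq f" "freq f \<le> 1" using N_pos by (auto simp: freq_def)
qed

lemma psi_sq: "(psi j)\<^sup>2 = (if j < 4 * N then 1 / (4 * real N) else 0)"
  by (simp add: psi_def power_divide)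

lemma sum_psi_sq: "(\<Sum>j<2 ^ (N + 1). (psi j)\<^sup>2) = 1"
proof -
  have "{..<2 ^ (N + 1)} \<inter> {j. j < 4 * N} = {..<4 * N}" using four_N_le by auto
  then show ?thesis unfolding psi_sq sum.If_cases[OF finite_lessThan] using N_pos by simp
qed

text \<open>Each good argument has two entries of weight \<open>1 / (4 * N)\<close>, one per value
  of the query bit; the factor 1/2 reflects the doubled range of arguments.\<close>

lemma sum_psi_sq_good: "(\<Sum>j<2 ^ (N + 1). if good f j then (psi j)\<^sup>2 else 0) = freq f / 2"
proof -
  have "(\<Sum>j<2 ^ (N + 1). if good f j then (psi j)\<^sup>2 else 0)
      = (\<Sum>i<2 ^ N. \<Sum>x<2. if good f (i * 2 + x) then (psi (i * 2 + x))\<^sup>2 else 0)"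
    unfolding power_add power_one_right by (rule sum_div_mod)
  also have "\<dots> = (\<Sum>i<2 ^ N. if i < N \<and> chi (f i) then 1 / (2 * real N) else 0)"
  proof (rule sum.cong[OF refl])
    fix i
    have "{..<2} = {0, 1 :: nat}" by auto
    then show "(\<Sum>x<2. if good f (i * 2 + x) then (psi (i * 2 + x))\<^sup>2 else 0)
      = (if i < N \<and> chi (f i) then 1 / (2 * real N) else 0)"
      by (auto simp: good_def psi_sq)
  qed
  also have "\<dots> = freq f / 2"
  proof -
    have "{..<2 ^ N} \<inter> {i. i < N \<and> chi (f i)} = {i. i < N \<and> chi (f i)}"
      using order.strict_trans[OF _ less_exp[of N]] by auto
    then show ?thesis unfolding sum.If_cases[OF finite_lessThan] by (simp add: freq_def)
  qed
  finally show ?thesis .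
qed

definition theta :: "(nat \<Rightarrow> real) \<Rightarrow> real" where
  "theta f = arcsin (sqrt (freq f / 2))"

lemma sin_theta_sq: "(sin (theta f))\<^sup>2 = freq f / 2"
proof -
  have "0 \<le> freq f / 2" "freq f / 2 \<le> 1" using freq_bounds[of f] by auto
  moreover from this have "sqrt (freq f / 2) \<le> 1" by simp
  moreover have "-1 \<le> sqrt (freq f / 2)"
    using \<open>0 \<le> freq f / 2\<close> real_sqrt_ge_zero by (meson dual_order.trans neg_le_0_iff_le zero_le_one)
  ultimately show ?thesis by (simp add: theta_def)
qed

text \<open>The upper bound keeps \<open>2 * theta f\<close> in the first quadrant, where the angle
  determines the frequency and the sine estimates apply.\<close>

lemma theta_bounds: "0 \<le> theta f" "theta f \<le> pi / 4"
proof -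
  have s: "0 \<le> sqrt (freq f / 2)" "sqrt (freq f / 2) \<le> sqrt (1 / 2)"
    using freq_bounds[of f] by auto
  have h: "sqrt (1 / 2) = sin (pi / 4)" by (simp add: sin_45 real_sqrt_divide) (simp add: field_simps)
  have "arcsin 0 \<le> arcsin (sqrt (freq f / 2))"
    using s order.trans[OF s(2)[unfolded h] sin_le_one] by (intro arcsin_le_arcsin) auto
  then show "0 \<le> theta f" by (simp add: theta_def)
  have "arcsin (sqrt (freq f / 2)) \<le> arcsin (sin (pi / 4))"
    using s unfolding h by (intro arcsin_le_arcsin) (auto intro: order.trans[of "-1" 0])
  also have "\<dots> = pi / 4" by (intro arcsin_sin) (use pi_gt_zero in linarith)+
  finally show "theta f \<le> pi / 4" by (simp add: theta_def)
qed

lemma cos_theta_pos: "cos (theta f) > 0"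
  using theta_bounds[of f] pi_gt_zero by (intro cos_gt_zero_pi) linarith+

lemma cos_theta_sq: "(cos (theta f))\<^sup>2 = 1 - freq f / 2"
  using sin_theta_sq[of f] sin_cos_squared_add[of "theta f"] by linarith

text \<open>The normalised components of \<^term>\<open>psi\<close> on and off the good indices.  If there are no good
  indices then \<^term>\<open>sin (theta f) = 0\<close> and division by zero makes \<open>gam\<close> vanish, as it should.\<close>

definition gam :: "(nat \<Rightarrow> real) \<Rightarrow> nat \<Rightarrow> real" where
  "gam f j = (if good f j then psi j else 0) / sin (theta f)"

definition del :: "(nat \<Rightarrow> real) \<Rightarrow> nat \<Rightarrow> real" where
  "del f j = (if good f j then 0 else psi j) / cos (theta f)"

lemma gam_del: "gam f j * del f j = 0"
  by (simp add: gam_def del_def)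

lemma sum_psi_gam: "(\<Sum>j<2 ^ (N + 1). psi j * gam f j) = sin (theta f)"
proof -
  have "(\<Sum>j<2 ^ (N + 1). psi j * gam f j)
      = (\<Sum>j<2 ^ (N + 1). if good f j then (psi j)\<^sup>2 else 0) / sin (theta f)"
    unfolding sum_divide_distrib by (intro sum.cong refl) (simp add: gam_def power2_eq_square)
  then show ?thesis
    unfolding sum_psi_sq_good sin_theta_sq[symmetric] by (simp add: power2_eq_square)
qed

lemma sum_psi_sq_bad: "(\<Sum>j<2 ^ (N + 1). if good f j then 0 else (psi j)\<^sup>2) = (cos (theta f))\<^sup>2"
proof -
  have "(\<Sum>j<2 ^ (N + 1). if good f j then 0 else (psi j)\<^sup>2)
     = (\<Sum>j<2 ^ (N + 1). (psi j)\<^sup>2 - (if good f j then (psi j)\<^sup>2 else 0))"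
    by (intro sum.cong refl) simp
  then show ?thesis by (simp only: sum_subtractf sum_psi_sq sum_psi_sq_good cos_theta_sq)
qed

lemma sum_psi_del: "(\<Sum>j<2 ^ (N + 1). psi j * del f j) = cos (theta f)"
proof -
  have "(\<Sum>j<2 ^ (N + 1). psi j * del f j)
      = (\<Sum>j<2 ^ (N + 1). if good f j then 0 else (psi j)\<^sup>2) / cos (theta f)"
    unfolding sum_divide_distrib by (intro sum.cong refl) (simp add: del_def power2_eq_square)
  then show ?thesis unfolding sum_psi_sq_bad by (simp add: power2_eq_square)
qed

lemma sum_gam_sq: "(\<Sum>j<2 ^ (N + 1). (gam f j)\<^sup>2) \<le> 1"
proof -
  have "(\<Sum>j<2 ^ (N + 1). (gam f j)\<^sup>2)
      = (\<Sum>j<2 ^ (N + 1). if good f j then (psi j)\<^sup>2 else 0) / (sin (theta f))\<^sup>2"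
    unfolding sum_divide_distrib by (intro sum.cong refl) (simp add: gam_def power_divide)
  then show ?thesis unfolding sum_psi_sq_good sin_theta_sq[symmetric] by simp
qed

lemma sum_del_sq: "(\<Sum>j<2 ^ (N + 1). (del f j)\<^sup>2) \<le> 1"
proof -
  have "(\<Sum>j<2 ^ (N + 1). (del f j)\<^sup>2)
      = (\<Sum>j<2 ^ (N + 1). if good f j then 0 else (psi j)\<^sup>2) / (cos (theta f))\<^sup>2"
    unfolding sum_divide_distrib by (intro sum.cong refl) (simp add: del_def power_divide)
  then show ?thesis unfolding sum_psi_sq_bad by simp
qed

lemma psi_flip: "good f j \<Longrightarrow> psi (flip j) = - psi j"
proof -
  assume "good f j"
  then have "j div 2 < N" by (simp add: good_def)
  then have "j < 4 * N" "flip j < 4 * N" by (auto simp: flip_def)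
  then show ?thesis by (auto simp: psi_def flip_def)
qed

lemma psi_decomp: "psi j = sin (theta f) * gam f j + cos (theta f) * del f j"
proof (cases "good f j \<and> sin (theta f) = 0")
  case True
  \<comment> \<open>The good indices have total mass zero here, so \<open>psi j = 0\<close> and the
    division by zero in \<open>gam\<close> does no harm.\<close>
  have "j \<in> {..<2 ^ (N + 1)}"
    using True four_N_le by (auto simp: good_def)
  moreover have "(\<Sum>j<2 ^ (N + 1). if good f j then (psi j)\<^sup>2 else 0) = 0"
    unfolding sum_psi_sq_good sin_theta_sq[symmetric] using True by simp
  ultimately have "(if good f j then (psi j)\<^sup>2 else 0) = 0"
    by (subst (asm) sum_nonneg_eq_0_iff) auto
  then show ?thesis using True by (simp add: gam_def del_def)
next
  case False
  then show ?thesis using cos_theta_pos[of f] by (auto simp: gam_def del_def)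
qed

text \<open>In every block \<open>y\<close> of the counter the state stays in the plane of \<open>gam\<close> and \<open>del\<close>.\<close>

definition vec :: "(nat \<Rightarrow> real) \<Rightarrow> (nat \<Rightarrow> real) \<Rightarrow> (nat \<Rightarrow> real) \<Rightarrow> nat \<Rightarrow> real" where
  "vec f u w k = (u (k mod T) * gam f (k div T) + w (k mod T) * del f (k div T)) / sqrt (real T)"

text \<open>Queries cannot be controlled, but two of them cancel.  A round of two queries, each followed by
  \<open>ctrl s\<close>, is a squared Grover iteration where \<open>s < y\<close> and the identity elsewhere, so after all
  rounds block \<open>y\<close> has undergone \<open>2 * y\<close> iterations.\<close>

definition ctrl :: "nat \<Rightarrow> cmat" where
  "ctrl s = on_high T (\<lambda>y. if s < y then hrefl psi (1 / 2) else hrefl (\<lambda>_. 0) 1)"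


section \<open>The circuit and its state before the Fourier transform\<close>

definition circuit :: "nat \<Rightarrow> cmat list" where
  "circuit S = prep_mat (\<lambda>k. psi (k div T) / sqrt (real T))
     # concat (map (\<lambda>s. [ctrl s, ctrl s]) [0..<S])"

lemma circuit_Suc: "circuit (Suc S) = (circuit S @ [ctrl S]) @ [ctrl S]"
  by (simp add: circuit_def)

lemma circuit_ne [simp]: "circuit S \<noteq> []"
  by (simp add: circuit_def)

lemma length_circuit: "length (circuit S) = 2 * S + 1"
  by (induction S) (simp_all add: circuit_Suc, simp add: circuit_def)

lemma unitary_ctrl: "unitary_mat (N + 1 + t) (ctrl s)"
  unfolding ctrl_def
proof (rule unitary_on_high)
  fix y :: nat
  show "unitary_mat (N + 1) (if s < y then hrefl psi (1 / 2) else hrefl (\<lambda>_. 0) 1)"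
  proof (cases "s < y")
    case False
    \<comment> \<open>With the zero vector \<open>hrefl\<close> is the identity. It needs its own
      proof since \<open>unitary_hrefl\<close> would require \<open>c = 0\<close>.\<close>
    have "unitary_mat (N + 1) (hrefl (\<lambda>_. 0) 1)"
      unfolding unitary_mat_def
    proof (intro allI impI)
      fix a b :: nat assume "a < 2 ^ (N + 1)"
      have "cnj (hrefl (\<lambda>_. 0) 1 j a) * hrefl (\<lambda>_. 0) 1 j b
        = (if j = a then if a = b then 1 else 0 else 0)" for j
        by (auto simp: hrefl_def)
      then show "(\<Sum>j<2 ^ (N + 1). cnj (hrefl (\<lambda>_. 0) 1 j a) * hrefl (\<lambda>_. 0) 1 j b)
        = (if a = b then 1 else 0)"
        using \<open>a < 2 ^ (N + 1)\<close> by simp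
    qed
    then show ?thesis using False by simp
  qed (use sum_psi_sq unitary_hrefl[of psi "N + 1" "1 / 2"] in simp)
qed

lemma prep_column:
  "prep_mat (\<lambda>k. psi (k div T) / sqrt (real T)) k 0 = of_real (psi (k div T) / sqrt (real T))"
  "unitary_mat (N + 1 + t) (prep_mat (\<lambda>k. psi (k div T) / sqrt (real T)))"
proof -
  \<comment> \<open>The prepared vector has an entry below 1 at index 0, which excludes the
    degenerate reflection.\<close>
  have "psi 0 = 1 / sqrt (4 * real N)" using N_pos by (simp add: psi_def)
  moreover have "sqrt (4 * real N) > 1" using N_pos by simp
  moreover have "sqrt (real T) \<ge> 1" by simp
  ultimately have "0 \<le> psi 0" "psi 0 < 1" "psi 0 / sqrt (real T) \<le> psi 0 / 1"
    by (auto intro!: divide_left_mono)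
  then have "psi (0 div T) / sqrt (real T) < 1" unfolding div_0 by linarith
  then have ne: "psi (0 div T) / sqrt (real T) \<noteq> 1" by simp
  show "prep_mat (\<lambda>k. psi (k div T) / sqrt (real T)) k 0 = of_real (psi (k div T) / sqrt (real T))"
    using ne by (rule prep_mat_column)
  have "(\<Sum>k<2 ^ (N + 1 + t). (psi (k div T) / sqrt (real T))\<^sup>2)
      = (\<Sum>j<2 ^ (N + 1). \<Sum>y<T. (psi j)\<^sup>2 / real T)"
    unfolding dim_eq sum_div_mod by (intro sum.cong refl) (simp add: power_divide)
  also have "\<dots> = 1" using sum_psi_sq by simp
  finally show "unitary_mat (N + 1 + t) (prep_mat (\<lambda>k. psi (k div T) / sqrt (real T)))"
    using ne by (rule unitary_prep_mat)
qed

lemma unitary_circuit: "\<forall>U\<in>set (circuit S). unitary_mat (N + 1 + t) U"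
  using prep_column(2) unitary_ctrl by (auto simp: circuit_def)

lemma vec_qf_perm: "vec f u w (qf_perm query f k) = vec f (\<lambda>y. - u y) w k"
proof (cases "good f (k div T)")
  case True
  then show ?thesis
    by (simp add: vec_def qf_perm_query gam_def del_def psi_flip)
next
  case False
  then show ?thesis by (simp add: vec_def qf_perm_query gam_def)
qed

lemma sum_psi_vec:
  assumes "y < T"
  shows "(\<Sum>j<2 ^ (N + 1). psi j * vec f u w (j * T + y))
    = (u y * sin (theta f) + w y * cos (theta f)) / sqrt (real T)"
proof -
  have "(\<Sum>j<2 ^ (N + 1). psi j * vec f u w (j * T + y))
     = (\<Sum>j<2 ^ (N + 1). (u y * (psi j * gam f j) + w y * (psi j * del f j)) / sqrt (real T))"
    using assms by (intro sum.cong refl) (simp add: vec_def algebra_simps)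
  then show ?thesis
    by (simp only: sum_divide_distrib[symmetric] sum.distrib sum_distrib_left[symmetric]
        sum_psi_gam sum_psi_del)
qed

text \<open>Up to normalisation \<open>m y\<close> is the inner product of \<open>psi\<close> with
  the state of block \<open>y\<close> after the query. Where \<open>s < y\<close> this is a full
  Grover step; in the other blocks just the sign from the query remains, and the second query of the
  round removes it.\<close>

lemma half_step:
  assumes "\<And>k. k < 2 ^ (N + 1 + t) \<Longrightarrow> V k 0 = of_real (vec f u w k)"
    and k: "k < 2 ^ (N + 1 + t)"
  defines "m y \<equiv> w y * cos (theta f) - u y * sin (theta f)"
  shows "mmul (N + 1 + t) (ctrl s) (mmul (N + 1 + t) (qmat query f) V) k 0 = of_real
    (vec f (\<lambda>y. if s < y then - u y - 2 * m y * sin (theta f) else - u y)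
       (\<lambda>y. if s < y then w y - 2 * m y * cos (theta f) else w y) k)"
proof -
  let ?y = "k mod T" and ?i = "k div T"
  let ?X = "if s < ?y then hrefl psi (1 / 2) else hrefl (\<lambda>_. 0) 1"
  have y: "?y < T" by simp
  have i: "?i < 2 ^ (N + 1)" using k unfolding dim_eq by (rule less_mult_imp_div_less)
  have QV: "mmul (N + 1 + t) (qmat query f) V l 0 = of_real (vec f (\<lambda>y. - u y) w l)"
    if "l < 2 ^ (N + 1 + t)" for l
    using that by (simp only: mmul_qmat assms(1)[OF qf_perm_less] vec_qf_perm)
  have "mmul (N + 1 + t) (ctrl s) (mmul (N + 1 + t) (qmat query f) V) k 0
      = (\<Sum>l<2 ^ (N + 1) * T. ctrl s k l * of_real (vec f (\<lambda>y. - u y) w l))"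
    unfolding mmul_def[of _ "ctrl s"] dim_eq using QV unfolding dim_eq by (intro sum.cong refl) simp
  also have "\<dots> = (\<Sum>j<2 ^ (N + 1). ?X ?i j * of_real (vec f (\<lambda>y. - u y) w (j * T + ?y)))"
    unfolding ctrl_def by (rule on_high_apply) simp
  finally have 1: "mmul (N + 1 + t) (ctrl s) (mmul (N + 1 + t) (qmat query f) V) k 0
      = (\<Sum>j<2 ^ (N + 1). ?X ?i j * of_real (vec f (\<lambda>y. - u y) w (j * T + ?y)))" .
  have alg: "(- u' * g + w' * d) / r - (s' * g + c * d) / (1 / 2) * (m' / r)
      = ((- u' - 2 * m' * s') * g + (w' - 2 * m' * c) * d) / r" for u' w' g d r s' c m' :: real
    by (simp add: add_divide_distrib diff_divide_distrib algebra_simps)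
  have "(\<Sum>j<2 ^ (N + 1). ?X ?i j * of_real (vec f (\<lambda>y. - u y) w (j * T + ?y))) = of_real
    (vec f (\<lambda>y. if s < y then - u y - 2 * m y * sin (theta f) else - u y)
       (\<lambda>y. if s < y then w y - 2 * m y * cos (theta f) else w y) k)"
  proof (cases "s < ?y")
    case True
    then have "(\<Sum>j<2 ^ (N + 1). ?X ?i j * of_real (vec f (\<lambda>y. - u y) w (j * T + ?y)))
       = of_real (vec f (\<lambda>y. - u y) w (?i * T + ?y) - psi ?i / (1 / 2) * (m ?y / sqrt (real T)))"
      by (simp only: if_True hrefl_apply[OF i] sum_psi_vec[OF y]) (simp add: m_def)
    also have "vec f (\<lambda>y. - u y) w (?i * T + ?y) - psi ?i / (1 / 2) * (m ?y / sqrt (real T))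
      = vec f (\<lambda>y. if s < y then - u y - 2 * m y * sin (theta f) else - u y)
       (\<lambda>y. if s < y then w y - 2 * m y * cos (theta f) else w y) k"
      unfolding psi_decomp[of ?i f] vec_def using True by (simp only: if_True div_mult_mod_eq alg)
    finally show ?thesis .
  next
    case False
    then show ?thesis
      by (simp only: if_False hrefl_apply[OF i]) (simp add: vec_def)
  qed
  with 1 show ?thesis by simp
qed

text \<open>\<open>psi\<close> itself has angle \<open>theta f\<close>. Block \<open>y\<close> is
  active in the rounds \<open>s < y\<close>, and an active round adds two rotations by
  \<open>2 * theta f\<close>.\<close>

definition angle :: "(nat \<Rightarrow> real) \<Rightarrow> nat \<Rightarrow> nat \<Rightarrow> real" where
  "angle f S y = real (4 * min y S + 1) * theta f"

lemma circuit_column: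
  assumes "k < 2 ^ (N + 1 + t)"
  shows "alg_mat query (circuit S) f k 0
    = of_real (vec f (\<lambda>y. sin (angle f S y)) (\<lambda>y. cos (angle f S y)) k)"
  using assms
proof (induction S arbitrary: k)
  case 0
  have "alg_mat query (circuit 0) f k 0 = of_real (psi (k div T) / sqrt (real T))"
    using prep_column(1) by (simp add: circuit_def alg_mat_def)
  then show ?case by (simp add: vec_def angle_def psi_decomp[of "k div T" f])
next
  case (Suc S)
  let ?a = "theta f" and ?n = "N + 1 + t"
  let ?x = "angle f S"
  \<comment> \<open>Halfway through a round: active blocks carry a global minus sign, idle blocks a
    minus sign on the \<open>gam\<close> coordinate alone. The second half cancels both.\<close>
  let ?u1 = "\<lambda>y. if S < y then - sin (?x y + 2 * ?a) else - sin (?x y)"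
  let ?w1 = "\<lambda>y. if S < y then - cos (?x y + 2 * ?a) else cos (?x y)"
  have 1: "alg_mat query (circuit S @ [ctrl S]) f k 0 = of_real (vec f ?u1 ?w1 k)"
    if "k < 2 ^ ?n" for k
    using half_step[where V = "alg_mat query (circuit S) f" and f = f and u = "\<lambda>y. sin (?x y)"
      and w = "\<lambda>y. cos (?x y)" and s = S, OF Suc.IH that]
    by (simp only: alg_mat_snoc[OF circuit_ne] query_simps rotation_step)
  have 2: "alg_mat query (circuit (Suc S)) f k 0 = of_real (vec f
     (\<lambda>y. if S < y then - ?u1 y - 2 * (?w1 y * cos ?a - ?u1 y * sin ?a) * sin ?a else - ?u1 y)
     (\<lambda>y. if S < y then ?w1 y - 2 * (?w1 y * cos ?a - ?u1 y * sin ?a) * cos ?a else ?w1 y) k)"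
    unfolding circuit_Suc 
    using half_step[where V = "alg_mat query (circuit S @ [ctrl S]) f" and f = f and u = ?u1
      and w = ?w1 and s = S, OF 1 Suc.prems]
    by (subst alg_mat_snoc) (simp_all only: query_simps, simp)
  have next_angle: "angle f (Suc S) y = (if S < y then ?x y + 2 * ?a + 2 * ?a else ?x y)" for y
  proof (cases "S < y")
    case True
    then have "min y (Suc S) = Suc S" "min y S = S" by auto
    then show ?thesis using True by (simp add: angle_def algebra_simps)
  qed (simp add: angle_def)
  have 3: "(if S < y then - ?u1 y - 2 * (?w1 y * cos ?a - ?u1 y * sin ?a) * sin ?a else - ?u1 y)
      = sin (angle f (Suc S) y)" for y
    using rotation_step(1)[of "?x y + 2 * ?a" ?a] by (simp add: next_angle algebra_simps)
  have 4: "(if S < y then ?w1 y - 2 * (?w1 y * cos ?a - ?u1 y * sin ?a) * cos ?a else ?w1 y)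
      = cos (angle f (Suc S) y)" for y
    using rotation_step(2)[of "?x y + 2 * ?a" ?a] by (simp add: next_angle algebra_simps)
  show ?case unfolding 2 3 4 ..
qed

section \<open>The state after the Fourier transform\<close>

definition final_circuit :: "cmat list" where
  "final_circuit = butlast (circuit (T - 1))
     @ [mmul (N + 1 + t) (on_low T (dft_mat T)) (last (circuit (T - 1)))]"

lemma length_final_circuit: "length final_circuit - 1 = 2 * (T - 1)"
  by (simp add: final_circuit_def length_circuit)

lemma valid_final_circuit: "valid_nm {..<N} query final_circuit"
proof -
  have "unitary_mat (N + 1 + t) (on_low T (dft_mat T))"
    by (rule unitary_on_low[OF unitary_dft_mat])
  then have "\<forall>U\<in>set final_circuit. unitary_mat (N + 1 + t) U"
    using unitary_circuit[of "T - 1"]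
    by (auto simp: final_circuit_def intro!: unitary_mat_mmul dest: in_set_butlastD)
  then show ?thesis by (simp add: valid_nm_def valid_query final_circuit_def)
qed

lemma final_circuit_total: "(\<Sum>k<2 ^ qm query. (cmod (alg_mat query final_circuit f k 0))\<^sup>2) = 1"
proof (rule unitary_mat_column)
  show "unitary_mat (qm query) (alg_mat query final_circuit f)"
    using valid_final_circuit unitary_qmat by (intro unitary_alg_mat) (auto simp: valid_nm_def)
qed simp

text \<open>The discrete Fourier coefficient at \<open>y\<close> of \<open>h\<close> sampled along
  the rotation angles: \<open>sin\<close> gives the coordinate along \<open>gam\<close>,
  \<open>cos\<close> the one along \<open>del\<close>.\<close>

definition amp :: "(nat \<Rightarrow> real) \<Rightarrow> (real \<Rightarrow> real) \<Rightarrow> nat \<Rightarrow> complex" where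
  "amp f h y = (\<Sum>z<T. cis (- (2 * pi * real y * real z / real T))
      * of_real (h (real (4 * z + 1) * theta f))) / of_nat T"

lemma final_circuit_column:
  assumes k: "k < 2 ^ (N + 1 + t)"
  shows "alg_mat query final_circuit f k 0
    = amp f sin (k mod T) * of_real (gam f (k div T)) + amp f cos (k mod T) * of_real (del f (k div T))"
proof -
  let ?i = "k div T" and ?y = "k mod T" and ?r = "complex_of_real (sqrt (real T))"
  have i: "?i < 2 ^ (N + 1)" using k unfolding dim_eq by (rule less_mult_imp_div_less)
  have rr: "?r * ?r = of_nat T"
    by (metis of_real_mult of_real_of_nat_eq real_sqrt_mult_self abs_of_nat)
  have lt: "?i * T + z < 2 ^ (N + 1 + t)" if "z < T" for z
  proof -
    have "(?i + 1) * T \<le> 2 ^ (N + 1) * T" using i by (intro mult_right_mono) auto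
    then show ?thesis using that unfolding dim_eq by simp
  qed
  have "alg_mat query final_circuit f k 0
      = (\<Sum>l<2 ^ (N + 1) * T. on_low T (dft_mat T) k l * alg_mat query (circuit (T - 1)) f l 0)"
    unfolding final_circuit_def 
    using alg_mat_post[OF circuit_ne, where Q = query and F = "on_low T (dft_mat T)" and f = f]
    by (simp add: mmul_def power_add mult.assoc)
  also have "\<dots> = (\<Sum>z<T. dft_mat T ?y z * alg_mat query (circuit (T - 1)) f (?i * T + z) 0)"
    using k unfolding dim_eq by (rule on_low_apply)
  also have "\<dots> = (\<Sum>z<T. cis (- (2 * pi * real ?y * real z / real T)) / ?r *
      of_real ((sin (real (4 * z + 1) * theta f) * gam f ?i + cos (real (4 * z + 1) * theta f) * del f ?i) / sqrt (real T)))"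
  proof (rule sum.cong[OF refl])
    fix z assume "z \<in> {..<T}"
    then have z: "z < T" by simp
    \<comment> \<open>Counters stay below \<open>T\<close>, so \<open>T - 1\<close> rounds give
      every block all of its iterations.\<close>
    then have "min z (T - 1) = z" by simp
    then show "dft_mat T ?y z * alg_mat query (circuit (T - 1)) f (?i * T + z) 0 =
      cis (- (2 * pi * real ?y * real z / real T)) / ?r *
      of_real ((sin (real (4 * z + 1) * theta f) * gam f ?i + cos (real (4 * z + 1) * theta f) * del f ?i) / sqrt (real T))"
      unfolding circuit_column[OF lt[OF z]] vec_def angle_def dft_mat_def using z by simp
  qed
  also have "\<dots> = (\<Sum>z<T. (cis (- (2 * pi * real ?y * real z / real T)) * of_real (sin (real (4 * z + 1) * theta f)) * of_real (gam f ?i)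
     + cis (- (2 * pi * real ?y * real z / real T)) * of_real (cos (real (4 * z + 1) * theta f)) * of_real (del f ?i)) / (?r * ?r))"
    by (intro sum.cong refl) (simp add: algebra_simps add_divide_distrib)
  also have "\<dots> = amp f sin ?y * of_real (gam f ?i) + amp f cos ?y * of_real (del f ?i)"
    unfolding rr amp_def
    by (simp add: sum_divide_distrib[symmetric] sum.distrib sum_distrib_right add_divide_distrib)
  finally show ?thesis .
qed

text \<open>\<open>gam\<close> and \<open>del\<close> have disjoint supports, so there are no cross
  terms. Only an inequality holds because \<open>gam\<close> vanishes when there are no good
  indices.\<close>

lemma prob_block:
  assumes "y < T"
  shows "(\<Sum>j<2 ^ (N + 1). (cmod (alg_mat query final_circuit f (j * T + y) 0))\<^sup>2)
    \<le> (cmod (amp f sin y))\<^sup>2 + (cmod (amp f cos y))\<^sup>2"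
proof -
  let ?X = "amp f sin y" and ?Y = "amp f cos y"
  have "(cmod (alg_mat query final_circuit f (j * T + y) 0))\<^sup>2
      = (cmod ?X)\<^sup>2 * (gam f j)\<^sup>2 + (cmod ?Y)\<^sup>2 * (del f j)\<^sup>2" if "j < 2 ^ (N + 1)" for j
  proof -
    have "(j + 1) * T \<le> 2 ^ (N + 1) * T" using that by (intro mult_right_mono) auto
    then have "j * T + y < 2 ^ (N + 1 + t)" using assms unfolding dim_eq by simp
    then have "alg_mat query final_circuit f (j * T + y) 0
      = ?X * of_real (gam f j) + ?Y * of_real (del f j)"
      using assms by (simp add: final_circuit_column)
    moreover have "gam f j = 0 \<or> del f j = 0" using gam_del[of f j] by simp
    ultimately show ?thesis by (auto simp: norm_mult power_mult_distrib)
  qed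
  then have "(\<Sum>j<2 ^ (N + 1). (cmod (alg_mat query final_circuit f (j * T + y) 0))\<^sup>2)
     = (cmod ?X)\<^sup>2 * (\<Sum>j<2 ^ (N + 1). (gam f j)\<^sup>2) + (cmod ?Y)\<^sup>2 * (\<Sum>j<2 ^ (N + 1). (del f j)\<^sup>2)"
    by (simp add: sum.distrib sum_distrib_left)
  also have "\<dots> \<le> (cmod ?X)\<^sup>2 * 1 + (cmod ?Y)\<^sup>2 * 1"
    by (intro add_mono mult_left_mono sum_gam_sq sum_del_sq) auto
  finally show ?thesis by simp
qed



section \<open>Distribution of the measured counter\<close>

lemma amp_combination:
  assumes "\<sigma> = 1 \<or> \<sigma> = - 1"
  shows "amp f cos y + \<i> * of_real \<sigma> * amp f sin y
    = cis (\<sigma> * theta f) * (\<Sum>z<T. cis (real z * (2 * (\<sigma> * (2 * theta f) - pi * real y / real T)))) / of_nat T"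
proof -
  \<comment> \<open>Recombining sine and cosine into one exponential of frequency
    \<open>\<sigma>\<close> turns the Fourier coefficient into a geometric sum.\<close>
  have cis_eq: "cis (\<sigma> * x) = of_real (cos x) + \<i> * of_real \<sigma> * of_real (sin x)" for x
    using assms by (auto simp: complex_eq_iff)
  have alg: "c * a + \<i> * s * (c * b) = c * (a + \<i> * s * b)" for a b c s :: complex
    by (simp add: algebra_simps)
  have "amp f cos y + \<i> * of_real \<sigma> * amp f sin y
     = (\<Sum>z<T. cis (- (2 * pi * real y * real z / real T)) * cis (\<sigma> * (real (4 * z + 1) * theta f))) / of_nat T"
    unfolding amp_def times_divide_eq_right sum_distrib_left add_divide_distrib[symmetric] sum.distrib[symmetric]
    unfolding cis_eq by (intro arg_cong2[where f = "(/)"] sum.cong refl alg)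
  also have "\<dots> = (\<Sum>z<T. cis (\<sigma> * theta f) * cis (real z * (2 * (\<sigma> * (2 * theta f) - pi * real y / real T)))) / of_nat T"
    by (intro arg_cong2[where f = "(/)"] sum.cong refl) (simp add: cis_mult field_simps)
  finally show ?thesis by (simp add: sum_distrib_left)
qed

text \<open>The state contains both frequencies \<open>4 * theta f\<close> and
  \<open>- 4 * theta f\<close>, so the counter concentrates near \<open>peak f\<close> and near
  \<open>T - peak f\<close>. Folding \<open>y\<close> with \<open>T - y\<close> merges the two
  peaks.\<close>

definition dist_end :: "nat \<Rightarrow> real" where
  "dist_end y = real (min y (T - y))"

definition peak :: "(nat \<Rightarrow> real) \<Rightarrow> real" where
  "peak f = 2 * theta f * real T / pi"

lemma amp_combination_le:
  assumes y: "y < T" and \<sigma>: "\<sigma> = 1 \<or> \<sigma> = - 1" and ne: "dist_end y \<noteq> peak f"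
  shows "cmod (amp f cos y + \<i> * of_real \<sigma> * amp f sin y) \<le> 1 / (2 * \<bar>dist_end y - peak f\<bar>)"
proof -
  let ?a = "2 * theta f" and ?x = "pi * real y / real T" and ?u = "pi * dist_end y / real T"
  have T: "real T > 0" by simp
  have a: "0 \<le> ?a" "?a \<le> pi / 2" using theta_bounds[of f] by auto
  have "2 * min y (n - y) \<le> n" for n :: nat by arith
  from this[of T] have "real (2 * min y (T - y)) \<le> real T" by (rule of_nat_mono)
  then have "2 * dist_end y \<le> real T" by (simp add: dist_end_def)
  then have "pi * (2 * dist_end y) \<le> pi * real T" by (intro mult_left_mono) auto
  then have u: "0 \<le> ?u" "?u \<le> pi / 2" using T by (auto simp: dist_end_def field_simps)
  \<comment> \<open>For one of the two signs this is an equality; the other sign gives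
    \<open>?a + ?u\<close>, where the sine is at least as large.\<close>
  have "\<bar>sin (?a - ?u)\<bar> \<le> \<bar>sin (\<sigma> * ?a - ?x)\<bar>"
  proof -
    note le = sin_add_ge_abs_sin_diff[OF a u]
    have "min a b = a \<or> min a b = b" for a b :: nat by linarith
    then consider "dist_end y = real y" | "dist_end y = real (T - y)"
      unfolding dist_end_def by metis
    then show ?thesis
    proof cases
      case 1
      then have "?u = ?x" by simp
      moreover have "\<bar>sin (- ?a - ?u)\<bar> = \<bar>sin (?a + ?u)\<bar>"
      proof -
        have "- ?a - ?u = - (?a + ?u)" by simp
        then show ?thesis by (simp only: sin_minus abs_minus_cancel)
      qed
      ultimately show ?thesis using \<sigma> le by auto
    next
      case 2
      then have "dist_end y = real T - real y" using y by (simp add: of_nat_diff)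
      then have x: "?x = pi - ?u" by (simp add: right_diff_distrib diff_divide_distrib)
      have "sin (?a - ?x) = - sin (?a + ?u)" unfolding x
        by (simp add: sin_add sin_diff)
      moreover have "sin (- ?a - ?x) = sin (?a - ?u)" unfolding x
        by (simp add: sin_add sin_diff)
      ultimately show ?thesis using \<sigma> le by auto
    qed
  qed
  moreover have "2 / pi * \<bar>?a - ?u\<bar> \<le> \<bar>sin (?a - ?u)\<bar>"
    by (rule abs_sin_ge) (use a u in linarith)
  moreover have "2 / pi * \<bar>?a - ?u\<bar> = 2 * \<bar>dist_end y - peak f\<bar> / real T"
  proof -
    have "?a - ?u = (pi / real T) * (peak f - dist_end y)"
      by (simp add: peak_def field_simps)
    then have "\<bar>?a - ?u\<bar> = (pi / real T) * \<bar>dist_end y - peak f\<bar>"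
      by (simp add: abs_mult abs_minus_commute)
    then show ?thesis by simp
  qed
  ultimately have sin_ge: "2 * \<bar>dist_end y - peak f\<bar> / real T \<le> \<bar>sin (\<sigma> * ?a - ?x)\<bar>" by linarith
  let ?S = "\<Sum>z<T. cis (real z * (2 * (\<sigma> * ?a - ?x)))"
  have "cmod ?S * \<bar>sin (\<sigma> * ?a - ?x)\<bar> \<le> 1"
    using geometric_cis_bound[of "2 * (\<sigma> * ?a - ?x)" T]
    unfolding nonzero_mult_div_cancel_left[OF numeral_neq_zero] .
  then have "cmod ?S * (2 * \<bar>dist_end y - peak f\<bar> / real T) \<le> 1"
    using mult_left_mono[OF sin_ge norm_ge_zero[of ?S]] by linarith
  then have "cmod ?S / real T \<le> 1 / (2 * \<bar>dist_end y - peak f\<bar>)"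
    using ne by (simp add: field_simps)
  then show ?thesis unfolding amp_combination[OF \<sigma>] 
    by (simp only: norm_mult norm_divide norm_cis mult_1_left norm_of_nat)
qed

text \<open>By the parallelogram identity, the squared norms of the sine and cosine coefficients add
  up to half the sum of those of the two exponential combinations.\<close>

lemma prob_outcome_le:
  assumes "y < T" "dist_end y \<noteq> peak f"
  shows "(cmod (amp f sin y))\<^sup>2 + (cmod (amp f cos y))\<^sup>2 \<le> 1 / (4 * (dist_end y - peak f)\<^sup>2)"
proof -
  let ?X = "amp f sin y" and ?Y = "amp f cos y" and ?b = "1 / (2 * \<bar>dist_end y - peak f\<bar>)"
  have b: "?b\<^sup>2 = 1 / (4 * (dist_end y - peak f)\<^sup>2)"
    by (simp add: power_divide power_mult_distrib)
  have "2 * ((cmod ?X)\<^sup>2 + (cmod ?Y)\<^sup>2) = (cmod (?Y + \<i> * of_real 1 * ?X))\<^sup>2 + (cmod (?Y + \<i> * of_real (- 1) * ?X))\<^sup>2"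
    by (simp add: cmod_power2) (simp add: power2_eq_square algebra_simps)
  also have "\<dots> \<le> ?b\<^sup>2 + ?b\<^sup>2"
    using amp_combination_le[OF assms(1) _ assms(2), of 1] amp_combination_le[OF assms(1) _ assms(2), of "- 1"]
    by (intro add_mono power_mono) auto
  finally show ?thesis unfolding b by simp
qed

lemma prob_far:
  assumes "d > 0"
  shows "(\<Sum>k\<in>{k. k < 2 ^ qm query \<and> \<bar>dist_end (k mod T) - peak f\<bar> > d}.
    (cmod (alg_mat query final_circuit f k 0))\<^sup>2) \<le> 2 / d"
proof (cases "d \<ge> 2")
  \<comment> \<open>For \<open>d < 2\<close> the claimed bound exceeds the total probability
    1.\<close>
  case False
  have "(\<Sum>k\<in>{k. k < 2 ^ qm query \<and> \<bar>dist_end (k mod T) - peak f\<bar> > d}.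
      (cmod (alg_mat query final_circuit f k 0))\<^sup>2)
    \<le> (\<Sum>k<2 ^ qm query. (cmod (alg_mat query final_circuit f k 0))\<^sup>2)"
    by (intro sum_mono2) auto
  also have "\<dots> \<le> 2 / d" unfolding final_circuit_total using False assms by simp
  finally show ?thesis .
next
  case True
  define h where "h v = (if \<bar>real v - peak f\<bar> > d then 1 / (real v - peak f)\<^sup>2 else 0)" for v :: nat
  have h0: "h v \<ge> 0" for v by (simp add: h_def)
  have "(\<Sum>k\<in>{k. k < 2 ^ qm query \<and> \<bar>dist_end (k mod T) - peak f\<bar> > d}.
      (cmod (alg_mat query final_circuit f k 0))\<^sup>2)
    = (\<Sum>k<2 ^ (N + 1) * T. if \<bar>dist_end (k mod T) - peak f\<bar> > d then
        (cmod (alg_mat query final_circuit f k 0))\<^sup>2 else 0)"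
    unfolding dim_eq[symmetric]
    by (subst sum.inter_filter[symmetric]) (auto intro!: sum.cong)
  also have "\<dots> = (\<Sum>y<T. \<Sum>j<2 ^ (N + 1). if \<bar>dist_end y - peak f\<bar> > d then
        (cmod (alg_mat query final_circuit f (j * T + y) 0))\<^sup>2 else 0)"
    unfolding sum_div_mod by (subst sum.swap) (intro sum.cong refl, simp)
  \<comment> \<open>As \<open>dist_end y\<close> is \<open>y\<close> or \<open>T - y\<close>, two
    inverse square tails suffice. Each is at most \<open>4 / d\<close>, and the factor 1/4 makes the
    total \<open>2 / d\<close>.\<close>
  also have "\<dots> \<le> (\<Sum>y<T. h y / 4 + h (T - y) / 4)"
  proof (rule sum_mono)
    fix y assume "y \<in> {..<T}"
    then have y: "y < T" by simp
    show "(\<Sum>j<2 ^ (N + 1). if \<bar>dist_end y - peak f\<bar> > d then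
        (cmod (alg_mat query final_circuit f (j * T + y) 0))\<^sup>2 else 0) \<le> h y / 4 + h (T - y) / 4"
    proof (cases "\<bar>dist_end y - peak f\<bar> > d")
      case far: True
      then have "(\<Sum>j<2 ^ (N + 1). if \<bar>dist_end y - peak f\<bar> > d then
        (cmod (alg_mat query final_circuit f (j * T + y) 0))\<^sup>2 else 0)
         \<le> (cmod (amp f sin y))\<^sup>2 + (cmod (amp f cos y))\<^sup>2"
        using prob_block[OF y] by simp
      also have "\<dots> \<le> 1 / (4 * (dist_end y - peak f)\<^sup>2)"
        using far assms by (intro prob_outcome_le y) auto
      also have "\<dots> = h (min y (T - y)) / 4"
        using far by (simp add: h_def dist_end_def)
      also have "\<dots> \<le> h y / 4 + h (T - y) / 4" using h0 by (simp add: min_def)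
      finally show ?thesis .
    qed (use h0 in simp)
  qed
  also have "\<dots> = (\<Sum>y<T. h y) / 4 + (\<Sum>y<T. h (T - y)) / 4"
    by (simp add: sum.distrib sum_divide_distrib)
  \<comment> \<open>The arguments \<open>T - y\<close> run through 1 to \<open>T\<close>, so the
    second tail reaches one step further than the first.\<close>
  also have "(\<Sum>y<T. h (T - y)) = (\<Sum>y<T. h (Suc y))"
    using sum.nat_diff_reindex[of "\<lambda>y. h (Suc y)" T]
    by (simp add: Suc_diff_Suc)
  also have "(\<Sum>y<T. h (Suc y)) \<le> (\<Sum>y<Suc T. h y)"
    unfolding sum.lessThan_Suc_shift using h0[of 0] by simp
  also have "(\<Sum>y<T. h y) / 4 + (\<Sum>y<Suc T. h y) / 4 \<le> (4 / d) / 4 + (4 / d) / 4"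
    unfolding h_def by (intro add_mono divide_right_mono sum_inverse_square_tail True) auto
  finally show ?thesis by simp
qed

text \<open>Inverts \<open>freq f = 1 - cos (2 * theta f)\<close>, with the observed angle in place
  of \<open>2 * theta f\<close>.\<close>

definition estimate :: "nat \<Rightarrow> real" where
  "estimate k = 1 - cos (pi * dist_end (k mod T) / real T)"

text \<open>The slope of \<open>1 - cos\<close> at \<open>2 * theta f\<close> is a sine of order
  \<open>sqrt (freq f)\<close>, so rare events are counted with a smaller absolute error; the
  quadratic term comes from the curvature.\<close>

lemma estimate_error:
  assumes "\<bar>dist_end (k mod T) - peak f\<bar> \<le> d"
  shows "\<bar>estimate k - freq f\<bar> \<le> 8 * (sqrt (freq f) * d / real T + (d / real T)\<^sup>2)"
proof -
  let ?u = "pi * dist_end (k mod T) / real T" and ?a = "2 * theta f"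
  let ?D = "?u - ?a"
  have d: "d \<ge> 0" using assms by linarith
  have "?D = (pi / real T) * (dist_end (k mod T) - peak f)"
    by (simp add: peak_def field_simps)
  then have "\<bar>?D\<bar> = (pi / real T) * \<bar>dist_end (k mod T) - peak f\<bar>" by (simp add: abs_mult)
  also have "\<dots> \<le> (4 / real T) * d"
    using assms pi_less_4 by (intro mult_mono divide_right_mono) auto
  finally have D: "\<bar>?D\<bar> \<le> 4 * (d / real T)" by simp
  have "freq f = 1 - cos ?a" using sin_theta_sq[of f] cos_double_sin[of "theta f"] by simp
  then have "\<bar>estimate k - freq f\<bar> = \<bar>cos ?a - cos ?u\<bar>" by (simp add: estimate_def)
  also have "\<dots> = 2 * \<bar>sin ((?a + ?u) / 2)\<bar> * \<bar>sin (?D / 2)\<bar>"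
    unfolding cos_diff_cos by (simp add: abs_mult)
  also have "\<dots> \<le> 2 * (2 * sqrt (freq f) + 2 * (d / real T)) * (2 * (d / real T))"
  proof -
    have s2: "\<bar>sin (?D / 2)\<bar> \<le> 2 * (d / real T)"
      using abs_sin_x_le_abs_x[of "?D / 2"] D by simp
    have "(?a + ?u) / 2 = ?a + ?D / 2" by (simp add: field_simps)
    then have "\<bar>sin ((?a + ?u) / 2)\<bar> = \<bar>sin ?a * cos (?D / 2) + cos ?a * sin (?D / 2)\<bar>"
      by (metis sin_add)
    also have "\<dots> \<le> \<bar>sin ?a\<bar> * 1 + 1 * \<bar>sin (?D / 2)\<bar>"
      by (rule order.trans[OF abs_triangle_ineq], unfold abs_mult)
        (intro add_mono mult_mono; simp)
    also have "\<bar>sin ?a\<bar> \<le> 2 * sqrt (freq f)"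
    proof -
      have "\<bar>sin (theta f)\<bar> = sqrt (freq f / 2)"
        unfolding sin_theta_sq[symmetric] by simp
      also have "\<dots> \<le> sqrt (freq f)" using freq_bounds[of f] by simp
      finally have "\<bar>sin (theta f)\<bar> * \<bar>cos (theta f)\<bar> \<le> sqrt (freq f) * 1"
        by (intro mult_mono) (use freq_bounds[of f] in auto)
      then show ?thesis by (simp add: sin_double abs_mult)
    qed
    finally have s1: "\<bar>sin ((?a + ?u) / 2)\<bar> \<le> 2 * sqrt (freq f) + 2 * (d / real T)"
      using s2 by simp
    show ?thesis by (intro mult_mono s1 s2) (use d freq_bounds[of f] in auto)
  qed
  also have "\<dots> = 8 * (sqrt (freq f) * d / real T + (d / real T)\<^sup>2)"
    by (simp add: power2_eq_square algebra_simps)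
  finally show ?thesis .
qed

section \<open>Rounding to a possible count\<close>

definition result :: "nat \<Rightarrow> real" where
  "result k = of_int (round (real N * estimate k)) / real N"

definition accurate :: "(nat \<Rightarrow> real) \<Rightarrow> real \<Rightarrow> nat \<Rightarrow> bool" where
  "accurate f e k \<longleftrightarrow> \<bar>result k - freq f\<bar> \<le> e \<and> (e < 1 / real N \<longrightarrow> result k = freq f)"

text \<open>The nearest integer is no further from \<open>N * estimate k\<close> than the true
  count, so rounding at most doubles the error. Two integers at distance below 1 coincide.\<close>

lemma result_accurate:
  assumes "\<bar>estimate k - freq f\<bar> \<le> e"
  shows "accurate f (2 * e) k"
proof -
  let ?m = "int (card {i. i < N \<and> chi (f i)})" and ?r = "round (real N * estimate k)"
  have N: "real N > 0" using N_pos by simp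
  have m: "freq f = of_int ?m / real N" by (simp add: freq_def)
  have "\<bar>real N * estimate k - of_int ?r\<bar> \<le> \<bar>real N * estimate k - of_int ?m\<bar>"
    by (rule round_diff_minimal)
  then have "\<bar>of_int ?r - of_int ?m\<bar> \<le> 2 * \<bar>real N * estimate k - of_int ?m\<bar>"
    by (smt (verit))
  also have "real N * estimate k - of_int ?m = real N * (estimate k - freq f)"
    using N by (simp add: m field_simps)
  also have "2 * \<bar>real N * (estimate k - freq f)\<bar> \<le> real N * (2 * e)"
    using assms N by (simp add: abs_mult)
  finally have le: "\<bar>real_of_int ?r - of_int ?m\<bar> \<le> real N * (2 * e)" .
  have eq: "result k - freq f = (of_int ?r - of_int ?m) / real N"
    by (simp add: result_def m diff_divide_distrib)
  have "\<bar>result k - freq f\<bar> \<le> 2 * e"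
    unfolding eq abs_divide using le N by (simp add: field_simps)
  moreover have "result k = freq f" if "2 * e < 1 / real N"
  proof -
    have "real N * (2 * e) < 1" using that N by (simp add: field_simps)
    then have "real_of_int \<bar>?r - ?m\<bar> < 1" using le by simp
    then have "?r = ?m" by linarith
    then show ?thesis using eq by simp
  qed
  ultimately show ?thesis by (simp add: accurate_def)
qed

lemma prob_inaccurate:
  assumes "d > 0"
  shows "(\<Sum>k\<in>{k. k < 2 ^ qm query \<and>
      \<not> accurate f (16 * (sqrt (freq f) * d / real T + (d / real T)\<^sup>2)) k}.
    (cmod (alg_mat query final_circuit f k 0))\<^sup>2) \<le> 2 / d"
proof -
  have acc: "accurate f (16 * (sqrt (freq f) * d / real T + (d / real T)\<^sup>2)) k"
    if "\<bar>dist_end (k mod T) - peak f\<bar> \<le> d" for k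
    using result_accurate[OF estimate_error[OF that]] by simp
  have "{k. k < 2 ^ qm query \<and> \<not> accurate f (16 * (sqrt (freq f) * d / real T + (d / real T)\<^sup>2)) k}
    \<subseteq> {k. k < 2 ^ qm query \<and> \<bar>dist_end (k mod T) - peak f\<bar> > d}"
    using acc not_less by blast
  then have "(\<Sum>k\<in>{k. k < 2 ^ qm query \<and>
      \<not> accurate f (16 * (sqrt (freq f) * d / real T + (d / real T)\<^sup>2)) k}.
      (cmod (alg_mat query final_circuit f k 0))\<^sup>2)
    \<le> (\<Sum>k\<in>{k. k < 2 ^ qm query \<and> \<bar>dist_end (k mod T) - peak f\<bar> > d}.
      (cmod (alg_mat query final_circuit f k 0))\<^sup>2)"
    by (intro sum_mono2) auto
  also have "\<dots> \<le> 2 / d" by (rule prob_far[OF assms])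
  finally show ?thesis .
qed

end

section \<open>Independent measurements\<close>

definition words :: "nat \<Rightarrow> (nat \<Rightarrow> nat) \<Rightarrow> nat list set" where
  "words L m = {xs. length xs = L \<and> (\<forall>l<L. xs ! l < m l)}"

lemma words_Suc: "words (Suc L) m = (\<lambda>(xs, x). xs @ [x]) ` (words L m \<times> {..<m L})"
proof (intro set_eqI iffI)
  fix ys assume "ys \<in> words (Suc L) m"
  then have ys: "length ys = Suc L" "\<And>l. l < Suc L \<Longrightarrow> ys ! l < m l" by (auto simp: words_def)
  then have "ys = butlast ys @ [ys ! L]"
    by (metis append_butlast_last_id diff_Suc_1 last_conv_nth length_0_conv nat.distinct(1))
  moreover have "butlast ys \<in> words L m"
    using ys by (auto simp: words_def nth_butlast)
  ultimately show "ys \<in> (\<lambda>(xs, x). xs @ [x]) ` (words L m \<times> {..<m L})"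
    using ys(2)[of L] by (intro image_eqI[of _ _ "(butlast ys, ys ! L)"]) auto
qed (auto simp: words_def nth_append less_Suc_eq)

lemma words_0: "words 0 m = {[]}"
  by (auto simp: words_def)

lemma finite_words [simp]: "finite (words L m)"
  by (induction L) (auto simp: words_Suc words_0)

lemma sum_words_prod:
  fixes g :: "nat \<Rightarrow> nat \<Rightarrow> 'a::comm_semiring_1"
  shows "(\<Sum>xs\<in>words L m. \<Prod>l<L. g l (xs ! l)) = (\<Prod>l<L. \<Sum>x<m l. g l x)"
proof (induction L)
  case 0
  then show ?case by (simp add: words_0)
next
  case (Suc L)
  have inj: "inj_on (\<lambda>(xs, x). xs @ [x]) (words L m \<times> {..<m L})"
    by (auto simp: inj_on_def)
  have "(\<Sum>xs\<in>words (Suc L) m. \<Prod>l<Suc L. g l (xs ! l))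
      = (\<Sum>(xs, x)\<in>words L m \<times> {..<m L}. (\<Prod>l<L. g l (xs ! l)) * g L x)"
    unfolding words_Suc sum.reindex[OF inj]
    by (intro sum.cong refl) (auto simp: words_def nth_append)
  also have "\<dots> = (\<Sum>xs\<in>words L m. \<Prod>l<L. g l (xs ! l)) * (\<Sum>x<m L. g L x)"
    by (simp add: sum.cartesian_product[symmetric] sum_product)
  finally show ?case using Suc by simp
qed

lemma words_union_bound:
  fixes P :: "nat \<Rightarrow> nat \<Rightarrow> real"
  assumes nonneg: "\<And>l x. P l x \<ge> 0" and total: "\<And>l. l < L \<Longrightarrow> (\<Sum>x<m l. P l x) = 1"
  shows "(\<Sum>xs\<in>{xs\<in>words L m. \<exists>l<L. bad l (xs ! l)}. \<Prod>l<L. P l (xs ! l))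
    \<le> (\<Sum>l<L. \<Sum>x\<in>{x. x < m l \<and> bad l x}. P l x)"
proof -
  let ?W = "\<lambda>xs. \<Prod>l<L. P l (xs ! l)"
  \<comment> \<open>\<open>P' l\<close> erases the values at coordinate \<open>l\<close> that are
    not bad. The event "coordinate \<open>l\<close> is bad" thus has product weights again, and its
    probability factors with all other coordinates summing to 1.\<close>
  define P' where "P' l i x = (if i = l \<and> \<not> bad l x then 0 else P i x)" for l i x
  have W0: "?W xs \<ge> 0" for xs by (intro prod_nonneg) (simp add: nonneg)
  have P': "(if bad l (xs ! l) then ?W xs else 0) = (\<Prod>i<L. P' l i (xs ! i))" if "l < L" for l xs
    using that by (auto simp: P'_def intro!: prod.cong prod_zero[symmetric])
  have sums: "(\<Sum>x<m i. P' l i x) = (if i = l then (\<Sum>x\<in>{x. x < m l \<and> bad l x}. P l x) else 1)"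
    if "i < L" for i l
  proof (cases "i = l")
    case True
    have "(\<Sum>x<m l. P' l l x) = (\<Sum>x<m l. if bad l x then P l x else 0)"
      by (intro sum.cong) (auto simp: P'_def)
    also have "\<dots> = (\<Sum>x\<in>{x. x < m l \<and> bad l x}. P l x)"
      by (subst sum.inter_filter[symmetric]) (auto intro!: sum.cong)
    finally show ?thesis using True by simp
  qed (simp add: P'_def total that)
  have "(\<Sum>xs\<in>{xs\<in>words L m. \<exists>l<L. bad l (xs ! l)}. ?W xs)
     = (\<Sum>xs\<in>words L m. if \<exists>l<L. bad l (xs ! l) then ?W xs else 0)"
    by (rule sum.inter_filter) simp
  also have "\<dots> \<le> (\<Sum>xs\<in>words L m. \<Sum>l<L. if bad l (xs ! l) then ?W xs else 0)"
  proof (rule sum_mono)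
    fix xs
    show "(if \<exists>l<L. bad l (xs ! l) then ?W xs else 0) \<le> (\<Sum>l<L. if bad l (xs ! l) then ?W xs else 0)"
    proof (cases "\<exists>l<L. bad l (xs ! l)")
      case True
      then obtain l where "l < L" "bad l (xs ! l)" by blast
      then show ?thesis
        using member_le_sum[of l "{..<L}" "\<lambda>l. if bad l (xs ! l) then ?W xs else 0"] W0 by auto
    next
      case False
      show ?thesis unfolding if_not_P[OF False] by (intro sum_nonneg) (simp add: W0)
    qed
  qed
  also have "\<dots> = (\<Sum>l<L. \<Sum>xs\<in>words L m. \<Prod>i<L. P' l i (xs ! i))"
    by (subst sum.swap) (simp add: P')
  also have "\<dots> = (\<Sum>l<L. \<Prod>i<L. \<Sum>x<m i. P' l i x)"
    unfolding sum_words_prod ..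
  also have "\<dots> = (\<Sum>l<L. \<Sum>x\<in>{x. x < m l \<and> bad l x}. P l x)"
    by (intro sum.cong refl) (simp add: sums)
  finally show ?thesis .
qed

text \<open>Every component starts in basis state 0 whatever was measured before, so the joint
  outcome distribution is a product.\<close>

definition count_alg ::
  "nat \<Rightarrow> nat \<Rightarrow> (nat \<Rightarrow> nat) \<Rightarrow> (nat \<Rightarrow> real \<Rightarrow> bool) \<Rightarrow> (nat \<Rightarrow> real) \<Rightarrow> (nat, real, real) qalg" where
  "count_alg N L t chi w =
    (map (\<lambda>l. (counting.query N (t l) (chi l), counting.final_circuit N (t l), \<lambda>_. 0)) [0..<L],
     \<lambda>xs. \<Sum>l<L. w l * counting.result N (t l) (xs ! l))"

lemma count_alg_simps:
  "nmeas (count_alg N L t chi w) = L"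
  "l < L \<Longrightarrow> cQ (count_alg N L t chi w) l = counting.query N (t l) (chi l)"
  "l < L \<Longrightarrow> cU (count_alg N L t chi w) l = counting.final_circuit N (t l)"
  "l < L \<Longrightarrow> cb (count_alg N L t chi w) l xs = 0"
  "outmap (count_alg N L t chi w) xs = (\<Sum>l<L. w l * counting.result N (t l) (xs ! l))"
  by (simp_all add: count_alg_def nmeas_def cQ_def cU_def cb_def outmap_def)

text \<open>The factor 16 is the 8 of \<open>estimate_error\<close>, doubled by rounding.\<close>

definition level_error :: "real \<Rightarrow> real \<Rightarrow> nat \<Rightarrow> real" where
  "level_error a d t = 16 * (sqrt a * d / 2 ^ t + (d / 2 ^ t)\<^sup>2)"

text \<open>Separates the quantum part from the analysis: \<open>err\<close> is a deterministic
  statement about arbitrary reals \<open>r\<close> that approximate the frequencies, and quantum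
  mechanics enters only through the query budget and the sum of failure probabilities.\<close>

lemma min_qerr_le_counting:
  fixes N L n :: nat and w d :: "nat \<Rightarrow> real"
  assumes N: "N \<ge> 1" and L: "L \<ge> 1"
    and queries: "(\<Sum>l<L. 2 * (2 ^ t l - 1)) \<le> n"
    and d: "\<And>l. l < L \<Longrightarrow> d l > 0" and fail: "(\<Sum>l<L. 2 / d l) \<le> 1 / 4"
    and err: "\<And>f r. f \<in> F \<Longrightarrow>
      (\<And>l. l < L \<Longrightarrow> \<bar>r l - counting.freq N (chi l) f\<bar> \<le> level_error (counting.freq N (chi l) f) (d l) (t l)) \<Longrightarrow>
      (\<And>l. l < L \<Longrightarrow> level_error (counting.freq N (chi l) f) (d l) (t l) < 1 / real N \<Longrightarrow> r l = counting.freq N (chi l) f) \<Longrightarrow>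
      \<bar>S f - (\<Sum>l<L. w l * r l)\<bar> \<le> \<epsilon>"
  shows "min_qerr {..<N} S F n \<le> ereal \<epsilon>"
proof -
  let ?A = "count_alg N L t chi w"
  interpret C: counting N "t l" "chi l" for l by unfold_locales (rule N)
  let ?e = "\<lambda>f l. level_error (C.freq l f) (d l) (t l)"
  let ?m = "\<lambda>l. 2 ^ qm (C.query l) :: nat"
  let ?P = "\<lambda>f l x. (cmod (alg_mat (C.query l) (C.final_circuit l) f x 0))\<^sup>2"
  have "valid_alg {..<N} ?A"
    using L by (auto simp: valid_alg_def count_alg_simps C.valid_final_circuit)
  moreover have "nqueries ?A = (\<Sum>l<L. 2 * (2 ^ t l - 1))"
    unfolding nqueries_def count_alg_simps(1)
    by (intro sum.cong refl) (simp add: count_alg_simps C.length_final_circuit[unfolded One_nat_def])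
  moreover have "qerr S ?A f \<le> ereal \<epsilon>" if f: "f \<in> F" for f
  proof -
    have out: "outcomes ?A = words L ?m"
      by (auto simp: outcomes_def words_def count_alg_simps)
    have "{xs\<in>outcomes ?A. norm (S f - outmap ?A xs) > \<epsilon>}
        \<subseteq> {xs\<in>words L ?m. \<exists>l<L. \<not> C.accurate l f (?e f l) (xs ! l)}"
    proof
      fix xs assume xs: "xs \<in> {xs\<in>outcomes ?A. norm (S f - outmap ?A xs) > \<epsilon>}"
      have "\<exists>l<L. \<not> C.accurate l f (?e f l) (xs ! l)"
      proof (rule ccontr)
        assume "\<not> ?thesis"
        then have "\<bar>S f - (\<Sum>l<L. w l * C.result l (xs ! l))\<bar> \<le> \<epsilon>"
          by (intro err[OF f]) (auto simp: C.accurate_def)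
        then show False using xs by (simp add: count_alg_simps)
      qed
      then show "xs \<in> {xs\<in>words L ?m. \<exists>l<L. \<not> C.accurate l f (?e f l) (xs ! l)}"
        using xs out by simp
    qed
    then have "(\<Sum>xs\<in>{xs\<in>outcomes ?A. norm (S f - outmap ?A xs) > \<epsilon>}. outprob ?A f xs)
      \<le> (\<Sum>xs\<in>{xs\<in>words L ?m. \<exists>l<L. \<not> C.accurate l f (?e f l) (xs ! l)}. outprob ?A f xs)"
      by (intro sum_mono2) (auto simp: outprob_def intro!: prod_nonneg)
    also have "\<dots> = (\<Sum>xs\<in>{xs\<in>words L ?m. \<exists>l<L. \<not> C.accurate l f (?e f l) (xs ! l)}. \<Prod>l<L. ?P f l (xs ! l))"
      unfolding outprob_def by (intro sum.cong refl) (simp add: count_alg_simps)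
    also have "\<dots> \<le> (\<Sum>l<L. \<Sum>x\<in>{x. x < ?m l \<and> \<not> C.accurate l f (?e f l) x}. ?P f l x)"
      by (rule words_union_bound) (simp_all only: C.final_circuit_total zero_le_power2)
    also have "\<dots> \<le> (\<Sum>l<L. 2 / d l)"
      using C.prob_inaccurate d by (intro sum_mono) (auto simp: level_error_def)
    also note fail
    finally show ?thesis unfolding qerr_def by (intro Inf_lower) blast
  qed
  ultimately have "?A \<in> {A. valid_alg {..<N} A \<and> nqueries A \<le> n}" "qerr_class S ?A F \<le> ereal \<epsilon>"
    using queries by (auto simp: qerr_class_def intro: SUP_least)
  then show ?thesis unfolding min_qerr_def by (rule INF_lower2)
qed

section \<open>Binary levels\<close>

definition bit_at :: "real \<Rightarrow> nat \<Rightarrow> real \<Rightarrow> bool" where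
  "bit_at u k x \<longleftrightarrow> odd \<lfloor>max x 0 / (u * 2 ^ k)\<rfloor>"

lemma bit_at_ge:
  assumes "u > 0" "bit_at u k x"
  shows "u * 2 ^ k \<le> x"
proof (rule ccontr)
  assume "\<not> ?thesis"
  then have "0 \<le> max x 0 / (u * 2 ^ k)" "max x 0 / (u * 2 ^ k) < 1"
    using assms(1) by (auto simp: divide_less_eq)
  then have "\<lfloor>max x 0 / (u * 2 ^ k)\<rfloor> = 0" by (simp add: floor_eq_iff)
  then show False using assms(2) by (simp add: bit_at_def)
qed

text \<open>Halving an integer splits off its parity, so the weighted bits telescope between the
  floors at scales \<open>u\<close> and \<open>u * 2 ^ R\<close>.\<close>

lemma sum_bits_eq:
  assumes "u > 0" "x \<ge> 0"
  shows "(\<Sum>k<R. if bit_at u k x then u * 2 ^ k else 0)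
    = u * (of_int \<lfloor>x / u\<rfloor> - 2 ^ R * of_int \<lfloor>x / (u * 2 ^ R)\<rfloor>)"
proof (induction R)
  case (Suc R)
  have half: "\<lfloor>y\<rfloor> = 2 * \<lfloor>y / 2\<rfloor> + (if odd \<lfloor>y\<rfloor> then 1 else 0)" for y :: real
  proof -
    have "\<lfloor>y / 2\<rfloor> = \<lfloor>y\<rfloor> div 2" using floor_divide_real_eq_div[of 2 y] by simp
    then show ?thesis by (auto elim!: oddE)
  qed
  let ?y = "x / (u * 2 ^ R)"
  have y2: "?y / 2 = x / (u * 2 ^ Suc R)" by (simp add: mult.commute mult.left_commute)
  have "real_of_int \<lfloor>?y\<rfloor> = 2 * of_int \<lfloor>x / (u * 2 ^ Suc R)\<rfloor> + (if bit_at u R x then 1 else 0)"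
    using arg_cong[OF half[of ?y], of real_of_int] assms(2) unfolding y2 bit_at_def
    by (simp add: max_def split: if_splits)
  then show ?case using Suc by (cases "bit_at u R x") (simp_all add: algebra_simps)
qed simp

lemma bit_expansion:
  assumes "u > 0" "x \<ge> 0" "x < u * 2 ^ R"
  shows "\<bar>x - (\<Sum>k<R. if bit_at u k x then u * 2 ^ k else 0)\<bar> \<le> u"
proof -
  have "\<lfloor>x / (u * 2 ^ R)\<rfloor> = 0" using assms by (simp add: floor_eq_iff divide_less_eq)
  then have "(\<Sum>k<R. if bit_at u k x then u * 2 ^ k else 0) = u * of_int \<lfloor>x / u\<rfloor>"
    using sum_bits_eq[OF assms(1,2)] by simp
  moreover have "x = u * (x / u)" using assms(1) by simp
  ultimately have "x - (\<Sum>k<R. if bit_at u k x then u * 2 ^ k else 0) = u * (x / u - of_int \<lfloor>x / u\<rfloor>)"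
    by (metis right_diff_distrib)
  also have "\<bar>\<dots>\<bar> \<le> u * 1"
    unfolding abs_mult using assms(1) by (intro mult_mono) (auto, linarith)
  finally show ?thesis by simp
qed

text \<open>Even indices enumerate the bits of the positive part, odd ones those of the negative
  part, so both signs form one family of measurements.\<close>

definition level :: "real \<Rightarrow> nat \<Rightarrow> real \<Rightarrow> bool" where
  "level u l v \<longleftrightarrow> bit_at u (l div 2) (if even l then v else - v)"

definition weight :: "real \<Rightarrow> nat \<Rightarrow> real" where
  "weight u l = (if even l then 1 else - 1) * (u * 2 ^ (l div 2))"

lemma sum_double: "(\<Sum>l<R * 2. g l) = (\<Sum>k<R. g (2 * k) + g (2 * k + 1))"
  for g :: "nat \<Rightarrow> 'a::comm_monoid_add"
proof -
  have "{..<2} = {0, 1 :: nat}" by auto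
  then show ?thesis unfolding sum_div_mod by (simp add: mult.commute)
qed

lemma level_expansion:
  assumes "u > 0" "\<bar>v\<bar> < u * 2 ^ R"
  shows "\<bar>v - (\<Sum>l<R * 2. if level u l v then weight u l else 0)\<bar> \<le> u"
proof -
  have no_bit: "\<not> bit_at u k x" if "x \<le> 0" for k x
    using bit_at_ge[OF assms(1), of k x] that assms(1) by (smt (verit) mult_pos_pos zero_less_power)
  have sum: "(\<Sum>l<R * 2. if level u l v then weight u l else 0)
     = (\<Sum>k<R. if bit_at u k v then u * 2 ^ k else 0) - (\<Sum>k<R. if bit_at u k (- v) then u * 2 ^ k else 0)"
    unfolding sum_double sum_subtractf[symmetric]
    by (intro sum.cong refl) (auto simp: level_def weight_def)
  show ?thesis
  proof (cases "v \<ge> 0")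
    case True
    then show ?thesis using bit_expansion[OF assms(1), of v R] assms(2)
      unfolding sum by (simp add: no_bit)
  next
    case False
    then show ?thesis using bit_expansion[OF assms(1), of "- v" R] assms(2)
      unfolding sum by (simp add: no_bit)
  qed
qed

section \<open>Frequencies of the levels for functions in the unit ball\<close>

lemma freq_eq: "N \<ge> 1 \<Longrightarrow> counting.freq N chi f = (\<Sum>i<N. if chi (f i) then 1 else 0) / real N"
proof -
  assume "N \<ge> 1"
  then interpret counting N 0 chi by unfold_locales
  have "{..<N} \<inter> {i. chi (f i)} = {i. i < N \<and> chi (f i)}" by auto
  then show ?thesis by (simp add: freq_def sum.If_cases)
qed

lemma mean_levels:
  assumes "N \<ge> 1" "u > 0" and f: "\<And>i. i < N \<Longrightarrow> \<bar>f i\<bar> < u * 2 ^ R"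
  shows "\<bar>SN N f - (\<Sum>l<R * 2. weight u l * counting.freq N (level u l) f)\<bar> \<le> u"
proof -
  have "(\<Sum>l<R * 2. weight u l * counting.freq N (level u l) f)
     = (\<Sum>l<R * 2. \<Sum>i<N. if level u l (f i) then weight u l else 0) / real N"
    unfolding freq_eq[OF assms(1)] sum_divide_distrib times_divide_eq_right sum_distrib_left
    by (intro sum.cong refl) (simp add: if_distrib)
  also have "\<dots> = (\<Sum>i<N. \<Sum>l<R * 2. if level u l (f i) then weight u l else 0) / real N"
    by (subst sum.swap) simp
  finally have "SN N f - (\<Sum>l<R * 2. weight u l * counting.freq N (level u l) f)
     = (\<Sum>i<N. f i - (\<Sum>l<R * 2. if level u l (f i) then weight u l else 0)) / real N"
    by (simp only: SN_def sum_subtractf diff_divide_distrib)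
  also have "\<bar>\<dots>\<bar> \<le> (\<Sum>i<N. u) / real N"
  proof -
    have "\<bar>\<Sum>i<N. f i - (\<Sum>l<R * 2. if level u l (f i) then weight u l else 0)\<bar> \<le> (\<Sum>i<N. u)"
      by (rule order.trans[OF sum_abs], rule sum_mono, rule level_expansion[OF assms(2) f]) simp
    then show ?thesis unfolding abs_divide abs_of_nat by (intro divide_right_mono) auto
  qed
  also have "\<dots> = u" using assms(1) by simp
  finally show ?thesis .
qed

lemma BpN_sum_le:
  assumes "f \<in> BpN N p" "N \<ge> 1" "p \<ge> 1"
  shows "(\<Sum>i<N. \<bar>f i\<bar> powr p) \<le> real N"
proof (rule ccontr)
  assume "\<not> ?thesis"
  then have "1 < 1 / real N * (\<Sum>i<N. \<bar>f i\<bar> powr p)"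
    using assms(2) by (simp add: field_simps)
  then have "1 < (1 / real N * (\<Sum>i<N. \<bar>f i\<bar> powr p)) powr (1 / p)"
    using assms(3) by (intro gr_one_powr) auto
  then show False using assms(1) by (simp add: BpN_def LpN_norm_def)
qed

lemma BpN_abs_le:
  assumes "f \<in> BpN N p" "N \<ge> 1" "p \<ge> 1" "i < N"
  shows "\<bar>f i\<bar> \<le> real N powr (1 / p)"
proof -
  have "\<bar>f i\<bar> powr p \<le> (\<Sum>i<N. \<bar>f i\<bar> powr p)"
    using assms(4) by (intro member_le_sum) auto
  also have "\<dots> \<le> real N" by (rule BpN_sum_le[OF assms(1-3)])
  finally have "(\<bar>f i\<bar> powr p) powr (1 / p) \<le> real N powr (1 / p)"
    using assms(3) by (intro powr_mono2) auto
  then show ?thesis using assms(3) by (simp add: powr_powr)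
qed

text \<open>Markov's inequality for the \<open>p\<close>-th power: a bit is set only where the
  absolute value of the function reaches the weight of the bit.\<close>

lemma freq_level_le:
  assumes "f \<in> BpN N p" "N \<ge> 1" "p \<ge> 1" "u > 0"
  shows "counting.freq N (level u l) f \<le> (u * 2 ^ (l div 2)) powr (- p)"
proof -
  let ?w = "u * 2 ^ (l div 2)"
  have w: "?w > 0" using assms(4) by simp
  have "(if level u l v then 1 else 0) * ?w powr p \<le> \<bar>v\<bar> powr p" for v
  proof (cases "level u l v")
    case True
    then have "?w \<le> \<bar>v\<bar>"
      using bit_at_ge[OF assms(4)] by (fastforce simp: level_def split: if_splits)
    then show ?thesis using w True assms(3) by (simp add: powr_mono2)
  qed simp
  then have "(\<Sum>i<N. if level u l (f i) then 1 else 0) * ?w powr p \<le> (\<Sum>i<N. \<bar>f i\<bar> powr p)"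
    unfolding sum_distrib_right by (intro sum_mono) auto
  also have "\<dots> \<le> real N" by (rule BpN_sum_le[OF assms(1-3)])
  finally have "(\<Sum>i<N. if level u l (f i) then 1 else 0) \<le> real N / ?w powr p"
    using w by (simp only: pos_le_divide_eq powr_gt_zero)
  then have "(\<Sum>i<N. if level u l (f i) then 1 else 0) / real N \<le> real N / ?w powr p / real N"
    by (rule divide_right_mono) simp
  also have "\<dots> = ?w powr (- p)"
    using assms(2) by (simp add: powr_minus divide_inverse)
  finally show ?thesis unfolding freq_eq[OF assms(2)] .
qed

text \<open>With truncated subtraction the exponent is the distance between \<open>k\<close> and
  \<open>b\<close>.\<close>

lemma sum_two_sided_geometric:
  fixes q :: real
  assumes "0 < q" "q < 1"
  shows "(\<Sum>k<b + r. q ^ ((k - b) + (b - k))) \<le> 2 / (1 - q)"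
proof -
  have geo: "(\<Sum>k<n. q ^ k) \<le> 1 / (1 - q)" for n
  proof -
    have "(\<Sum>k<n. q ^ k) = (1 - q ^ n) / (1 - q)" using assms by (simp add: sum_gp_strict)
    also have "\<dots> \<le> 1 / (1 - q)" using assms by (intro divide_right_mono) auto
    finally show ?thesis .
  qed
  have "(\<Sum>k<b + r. q ^ ((k - b) + (b - k))) = (\<Sum>k<b. q ^ (b - k)) + (\<Sum>k<r. q ^ k)"
    by (induction r) simp_all
  also have "(\<Sum>k<b. q ^ (b - k)) = (\<Sum>k<b. q ^ Suc k)"
    using sum.nat_diff_reindex[of "\<lambda>k. q ^ Suc k" b] by (simp add: Suc_diff_Suc)
  also have "\<dots> \<le> (\<Sum>k<b. q ^ k)"
    using assms by (intro sum_mono power_decreasing) auto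
  finally show ?thesis using geo[of b] geo[of r] by simp
qed

text \<open>Counter sizes are powers of two, so a budget \<open>x\<close> has to be rounded. Budgets
  below 1 get \<open>t = 0\<close>, where the circuit makes no query at all; this keeps arbitrarily
  many remote levels affordable.\<close>

lemma ex_power_two_between: "\<exists>t. 2 ^ t \<le> max 1 x \<and> x < 2 * 2 ^ t" for x :: real
proof -
  obtain s where s: "x < 2 ^ s" using real_arch_pow[of 2 x] by auto
  define t where "t = (LEAST s. x < 2 * 2 ^ s)"
  have "x < 2 * 2 ^ s" using s by (smt (verit) zero_less_power)
  then have "x < 2 * 2 ^ t" unfolding t_def by (rule LeastI)
  moreover have "2 ^ t \<le> max 1 x"
  proof (cases t)
    case (Suc t')
    then have "\<not> x < 2 * 2 ^ t'" using not_less_Least[of t' "\<lambda>s. x < 2 * 2 ^ s"] by (simp add: t_def)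
    then show ?thesis using Suc by simp
  qed simp
  ultimately show ?thesis by blast
qed

section \<open>Balancing the levels\<close>

lemma level_error_le:
  assumes "0 \<le> a" "a \<le> w powr (- p)" "w > 0" "0 \<le> d" "d / 2 ^ t \<le> y"
  shows "level_error a d t \<le> 16 * (w powr (- p / 2) * y + y\<^sup>2)"
proof -
  have d: "0 \<le> d / 2 ^ t" using assms(4) by simp
  have "sqrt a \<le> sqrt (w powr (- p))" using assms(2) by simp
  also have "\<dots> = (w powr (- p)) powr (1 / 2)" by (rule powr_half_sqrt[symmetric]) simp
  also have "\<dots> = w powr (- p / 2)" by (simp add: powr_powr)
  finally have "sqrt a * (d / 2 ^ t) \<le> w powr (- p / 2) * y"
    using assms(5) d by (intro mult_mono) auto
  moreover have "(d / 2 ^ t)\<^sup>2 \<le> y\<^sup>2" using assms(5) d by (intro power_mono) auto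
  ultimately show ?thesis by (simp add: level_error_def)
qed

text \<open>Both parts of the error are at most \<open>1 / (4 * N)\<close> thanks to
  \<open>B = 64 * E\<close>. In the linear part the decay of \<open>w powr (- p / 2)\<close> beats
  the growth of \<open>d / 2 ^ t\<close>. The quadratic part has no such decay; it is controlled by
  the range of the weights and by \<open>nE\<close>.\<close>

lemma level_error_coarse:
  fixes p M E B a d :: real and n N m t :: nat
  assumes p: "1 \<le> p" "p < 2" and N: "N \<ge> 1" and n: "n \<ge> 1"
    and M: "M > 0" "M powr (p / 2) = B * real N / real n"
    and E: "E > 0" "B = 64 * E" and nE: "real n \<ge> E * sqrt (real N)"
    and w: "M * 2 ^ m \<le> real N powr (1 / p)"
    and a: "0 \<le> a" "a \<le> (M * 2 ^ m) powr (- p)"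
    and d: "0 \<le> d" "d / 2 ^ t \<le> E / real n * 2 powr (2 * ((2 - p) / 8) * real m)"
  shows "level_error a d t < 1 / real N"
proof -
  define \<epsilon> where "\<epsilon> = (2 - p) / 8"
  define \<beta> where "\<beta> = E / real n"
  have \<beta>: "\<beta> > 0" using E n by (simp add: \<beta>_def)
  let ?y = "\<beta> * 2 powr (2 * \<epsilon> * real m)"
  have Mp: "M powr (- p / 2) = real n / (B * real N)"
    using M(2) by (simp add: powr_minus)
  have "(M * 2 ^ m) powr (- p / 2) * ?y = M powr (- p / 2) * \<beta> * 2 powr (real m * (- p / 2) + 2 * \<epsilon> * real m)"
  proof -
    have "(M * 2 ^ m) powr (- p / 2) = M powr (- p / 2) * 2 powr (real m * (- p / 2))"
      using M(1) by (simp add: powr_mult powr_realpow[symmetric] powr_powr)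
    then show ?thesis by (simp only: powr_add mult.assoc mult.left_commute)
  qed
  also have "\<dots> \<le> M powr (- p / 2) * \<beta> * 2 powr 0"
  proof -
    have "real m * (- p / 2) + 2 * \<epsilon> * real m = real m * ((2 - p) / 4 - p / 2)"
      by (simp add: \<epsilon>_def field_simps)
    also have "\<dots> \<le> 0" using p by (intro mult_nonneg_nonpos) auto
    finally show ?thesis using \<beta> by (intro mult_left_mono powr_mono) auto
  qed
  finally have 1: "(M * 2 ^ m) powr (- p / 2) * ?y \<le> \<beta> * (real n / (B * real N))"
    unfolding Mp by (simp add: mult.commute)
  have "?y\<^sup>2 = \<beta>\<^sup>2 * 2 powr (4 * \<epsilon> * real m)"
    by (simp add: power_mult_distrib powr_power mult.commute mult.left_commute)
  \<comment> \<open>Since \<open>4 * \<epsilon> \<le> p / 2\<close>, the growth can be traded for a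
    power of \<open>2 ^ m\<close> that the upper bound on the weight turns into a power of
    \<open>N\<close>.\<close>
  also have "\<dots> \<le> \<beta>\<^sup>2 * 2 powr (real m * (p / 2))"
  proof -
    have "real m * (4 * \<epsilon>) \<le> real m * (p / 2)"
      using p by (intro mult_left_mono) (auto simp: \<epsilon>_def)
    then show ?thesis by (intro mult_left_mono powr_mono) (auto simp: mult_ac)
  qed
  also have "2 powr (real m * (p / 2)) = (2 ^ m) powr (p / 2)"
    by (simp add: powr_realpow[symmetric] powr_powr)
  also have "\<dots> \<le> (real N powr (1 / p) / M) powr (p / 2)"
    using w M(1) p by (intro powr_mono2) (auto simp: field_simps)
  also have "\<dots> = sqrt (real N) * (real n / (B * real N))"
    using M p N n by (simp add: powr_divide powr_powr powr_half_sqrt)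
  finally have 2: "?y\<^sup>2 \<le> \<beta>\<^sup>2 * (sqrt (real N) * (real n / (B * real N)))"
    by (simp add: mult_left_mono)
  have "level_error a d t \<le> 16 * ((M * 2 ^ m) powr (- p / 2) * ?y + ?y\<^sup>2)"
    using a d M(1) by (intro level_error_le) (auto simp: \<beta>_def \<epsilon>_def)
  also have "\<dots> \<le> 16 * (\<beta> * (real n / (B * real N)) + \<beta>\<^sup>2 * (sqrt (real N) * (real n / (B * real N))))"
    using 1 2 by simp
  also have "\<dots> = (1 + E * sqrt (real N) / real n) / (4 * real N)"
    using E N n by (simp add: \<beta>_def power2_eq_square field_simps)
  also have "\<dots> \<le> (1 + 1) / (4 * real N)"
    using nE n by (intro divide_right_mono add_left_mono) (auto simp: divide_le_eq)
  also have "\<dots> < 1 / real N" using N by (simp add: field_simps)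
  finally show ?thesis .
qed

text \<open>In the linear part the factor \<open>w powr (1 - p / 2)\<close> falls like
  \<open>2 powr (- 4 * \<epsilon> * m)\<close>, while \<open>d / 2 ^ t\<close> grows only like
  \<open>2 powr (2 * \<epsilon> * m)\<close>. The quadratic part loses
  \<open>2 powr (4 * \<epsilon> * m)\<close> against the weight \<open>2 powr (- m)\<close>. A
  geometric factor survives in both because \<open>p < 2\<close>.\<close>

lemma level_error_fine:
  fixes p M E a d :: real and n m t :: nat
  assumes p: "1 \<le> p" "p < 2" and n: "n \<ge> 1" and M: "M > 0" and E: "E > 0"
    and a: "0 \<le> a" "a \<le> (M / 2 ^ m) powr (- p)"
    and d: "0 \<le> d" "d / 2 ^ t \<le> E / real n * 2 powr (2 * ((2 - p) / 8) * real m)"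
  shows "M / 2 ^ m * level_error a d t
    \<le> 16 * (M powr (1 - p / 2) * (E / real n) + M * (E / real n)\<^sup>2) * 2 powr (- ((2 - p) / 8) * real m)"
proof -
  define \<epsilon> where "\<epsilon> = (2 - p) / 8"
  define \<beta> where "\<beta> = E / real n"
  have \<beta>: "\<beta> > 0" using E n by (simp add: \<beta>_def)
  let ?y = "\<beta> * 2 powr (2 * \<epsilon> * real m)" and ?w = "M / 2 ^ m" and ?g = "2 powr (- \<epsilon> * real m)"
  have w: "?w > 0" using M by simp
  have weq: "?w = M * 2 powr (- real m)"
    by (simp add: powr_minus powr_realpow divide_inverse)
  have "?w * (?w powr (- p / 2) * ?y) = ?w powr (1 - p / 2) * ?y"
    using w M powr_add[of ?w 1 "- p / 2"] by simp
  also have "?w powr (1 - p / 2) = M powr (1 - p / 2) * 2 powr (- real m * (1 - p / 2))"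
    unfolding weq using M by (simp add: powr_mult powr_powr)
  also have "\<dots> * ?y = M powr (1 - p / 2) * \<beta> * 2 powr (- real m * (1 - p / 2) + 2 * \<epsilon> * real m)"
    unfolding powr_add by simp
  also have "\<dots> \<le> M powr (1 - p / 2) * \<beta> * ?g"
  proof -
    have "- real m * (1 - p / 2) + 2 * \<epsilon> * real m = real m * (- (2 * \<epsilon>))"
      by (simp add: \<epsilon>_def field_simps)
    also have "\<dots> \<le> real m * (- \<epsilon>)"
      using p by (intro mult_left_mono) (auto simp: \<epsilon>_def)
    also have "\<dots> = - \<epsilon> * real m" by simp
    finally show ?thesis using \<beta> by (intro mult_left_mono powr_mono) auto
  qed
  finally have 1: "?w * (?w powr (- p / 2) * ?y) \<le> M powr (1 - p / 2) * \<beta> * ?g" .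
  have "?w * ?y\<^sup>2 = M * \<beta>\<^sup>2 * (2 powr (- real m) * 2 powr (4 * \<epsilon> * real m))"
    unfolding weq by (simp add: power_mult_distrib powr_power mult.commute mult.left_commute)
  also have "\<dots> = M * \<beta>\<^sup>2 * 2 powr (- real m + 4 * \<epsilon> * real m)"
    unfolding powr_add ..
  also have "\<dots> \<le> M * \<beta>\<^sup>2 * ?g"
  proof -
    have "- real m + 4 * \<epsilon> * real m = real m * (4 * \<epsilon> - 1)" by (simp add: algebra_simps)
    also have "\<dots> \<le> real m * (- \<epsilon>)"
      using p by (intro mult_left_mono) (auto simp: \<epsilon>_def field_simps)
    also have "\<dots> = - \<epsilon> * real m" by simp
    finally show ?thesis using M by (intro mult_left_mono powr_mono) auto
  qed
  finally have 2: "?w * ?y\<^sup>2 \<le> M * \<beta>\<^sup>2 * ?g" .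
  have "level_error a d t \<le> 16 * (?w powr (- p / 2) * ?y + ?y\<^sup>2)"
    using a d w by (intro level_error_le) (auto simp: \<beta>_def \<epsilon>_def)
  then have "?w * level_error a d t \<le> ?w * (16 * (?w powr (- p / 2) * ?y + ?y\<^sup>2))"
    using w by (intro mult_left_mono) auto
  also have "\<dots> = 16 * (?w * (?w powr (- p / 2) * ?y) + ?w * ?y\<^sup>2)"
    by (simp only: distrib_left mult.left_commute)
  also have "\<dots> \<le> 16 * (M powr (1 - p / 2) * \<beta> * ?g + M * \<beta>\<^sup>2 * ?g)"
    by (intro mult_left_mono add_mono 1 2) simp
  also have "\<dots> = 16 * (M powr (1 - p / 2) * \<beta> + M * \<beta>\<^sup>2) * ?g"
    by (simp only: distrib_right mult.assoc)
  finally show ?thesis by (simp only: \<beta>_def \<epsilon>_def)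
qed

text \<open>\<open>H\<close> bounds the two-sided geometric sum over the bit positions, hence
  \<open>2 * H\<close> the sum over all levels. \<open>E\<close> is the constant that the budgets
  produce in \<open>d / 2 ^ t\<close>, and \<open>B\<close> is chosen to make the coarse levels
  exact.\<close>

lemma min_qerr_SN_le:
  fixes p \<epsilon> H E B X :: real and n N :: nat
  assumes p: "1 \<le> p" "p < 2" and N: "N \<ge> 1" and n: "n \<ge> 1"
  defines "\<epsilon> \<equiv> (2 - p) / 8"
  defines "H \<equiv> 2 / (1 - 2 powr (- \<epsilon>))"
  defines "E \<equiv> 128 * H\<^sup>2"
  defines "B \<equiv> 64 * E"
  defines "X \<equiv> real n powr (- 2 / p) * real N powr (2 / p - 1)"
  assumes nE: "real n \<ge> E * sqrt (real N)"
  shows "min_qerr {..<N} (SN N) (BpN N p) n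
    \<le> ereal ((1 + 32 * H * (E * B powr (2 / p - 1) + B powr (2 / p))) * X)"
proof -
  define q where "q = 2 powr (- \<epsilon>)"
  have q: "0 < q" "q < 1" using p by (auto simp: q_def \<epsilon>_def intro!: powr_less_one)
  have H: "H > 0" using q by (simp add: H_def q_def)
  have E: "E > 0" using H by (simp add: E_def)
  have B_eq: "B = 64 * E" by (simp only: B_def)
  have B: "B > 0" using E by (simp add: B_def)
  have X: "X > 0" using N n by (simp add: X_def)
  define M where "M = (B * real N / real n) powr (2 / p)"
  have base: "B * real N / real n > 0" using B N n by simp
  then have M: "M > 0" using B N n by (simp add: M_def)
  have Mp: "M powr (p / 2) = B * real N / real n"
    using base B p by (simp add: M_def powr_powr)
  \<comment> \<open>The finest weight \<open>M / 2 ^ b\<close> bounds the truncation error, so it is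
    pushed below the target \<open>X\<close>. \<open>b \<ge> 1\<close> guarantees at least one
    level.\<close>
  obtain b where b: "b \<ge> 1" "M / 2 ^ b \<le> X"
  proof -
    obtain b where "M / X < 2 ^ b" using real_arch_pow[of 2 "M / X"] by auto
    then have "M < X * 2 ^ b" using X by (simp add: divide_less_eq mult.commute)
    also have "\<dots> \<le> X * 2 ^ Suc b" using X by simp
    finally have "M / 2 ^ Suc b \<le> X" by (simp add: divide_le_eq)
    then show ?thesis using that[of "Suc b"] by simp
  qed
  \<comment> \<open>The levels must exceed all function values, yet minimality is needed too: each
    weight actually used stays within \<open>N powr (1 / p)\<close>, as the coarse estimate
    requires.\<close>
  define r where "r = (LEAST r. real N powr (1 / p) < M * 2 ^ r)"
  have "\<exists>r. real N powr (1 / p) < M * 2 ^ r"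
    using real_arch_pow[of 2 "real N powr (1 / p) / M"] M by (auto simp: divide_less_eq mult.commute)
  then have r: "real N powr (1 / p) < M * 2 ^ r" unfolding r_def by (rule LeastI_ex)
  have r_least: "M * 2 ^ i \<le> real N powr (1 / p)" if "i < r" for i
    using not_less_Least[OF that[unfolded r_def]] by simp
  define R where "R = b + r"
  define u where "u = M / 2 ^ b"
  have u: "u > 0" using M by (simp add: u_def)
  have uR: "u * 2 ^ R = M * 2 ^ r" by (simp add: u_def R_def power_add)
  define m where "m k = (k - b) + (b - k)" for k
  define g where "g l = q ^ m (l div 2)" for l
  have g: "g l > 0" for l using q by (simp add: g_def)
  have g_powr: "g l = 2 powr (- \<epsilon> * real (m (l div 2)))" for l
    by (simp add: g_def q_def powr_power mult.commute)
  have g_sum: "(\<Sum>l<R * 2. g l) \<le> 2 * H"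
  proof -
    have "(\<Sum>l<R * 2. g l) = 2 * (\<Sum>k<b + r. q ^ ((k - b) + (b - k)))"
      unfolding sum_double by (simp add: g_def m_def R_def sum_distrib_left)
    also have "\<dots> \<le> 2 * (2 / (1 - q))"
      by (intro mult_left_mono sum_two_sided_geometric q) simp
    finally show ?thesis by (simp add: H_def q_def)
  qed
  \<comment> \<open>A level costs at most \<open>2 * x l\<close> queries, and the sum of
    \<open>g\<close> is at most \<open>2 * H\<close>, so the total stays within
    \<open>n\<close>.\<close>
  define x where "x l = real n / (4 * H) * g l" for l
  have x: "x l > 0" for l using g n H by (simp add: x_def)
  obtain t where t: "\<And>l. 2 ^ t l \<le> max 1 (x l)" "\<And>l. x l < 2 * 2 ^ t l"
  proof -
    have "\<forall>l. \<exists>t. 2 ^ t \<le> max 1 (x l) \<and> x l < 2 * 2 ^ t"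
      by (intro allI ex_power_two_between)
    from choice[OF this] show ?thesis using that by blast
  qed
  \<comment> \<open>The failure probabilities \<open>2 / d l = g l / (8 * H)\<close> add up to at
    most 1/4. Since \<open>2 ^ t l\<close> exceeds \<open>x l / 2\<close>, the quotient
    \<open>d l / 2 ^ t l\<close> carries the constant 16 * 8 = 128 of \<open>E\<close>.\<close>
  define d where "d l = 16 * H / g l" for l
  have d: "d l > 0" for l using g H by (simp add: d_def)
  have dt: "d l / 2 ^ t l \<le> E / real n * 2 powr (2 * \<epsilon> * real (m (l div 2)))" for l
  proof -
    have "d l / 2 ^ t l \<le> d l / (x l / 2)"
      using t(2)[of l] x[of l] d[of l] by (intro divide_left_mono) auto
    also have "\<dots> = E / real n * (1 / g l)\<^sup>2"
      using g[of l] H n by (simp add: d_def x_def E_def power2_eq_square field_simps)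
    also have "(1 / g l)\<^sup>2 = 2 powr (2 * \<epsilon> * real (m (l div 2)))"
    proof -
      have "1 / g l = 2 powr (\<epsilon> * real (m (l div 2)))"
        by (simp add: g_powr powr_minus_divide)
      then show ?thesis by (simp add: powr_power mult_ac)
    qed
    finally show ?thesis .
  qed
  let ?a = "\<lambda>f l. counting.freq N (level u l) f"
  let ?C = "16 * (M powr (1 - p / 2) * (E / real n) + M * (E / real n)\<^sup>2)"
  have a: "0 \<le> ?a f l" for f l
    by (rule counting.freq_bounds(1)) (unfold_locales, rule N)
  have coarse: "level_error (?a f l) (d l) (t l) < 1 / real N"
    if f: "f \<in> BpN N p" and l: "l < R * 2" "\<not> l div 2 < b" for f l
  proof -
    have w: "u * 2 ^ (l div 2) = M * 2 ^ m (l div 2)"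
    proof -
      have "2 ^ (l div 2) = (2 :: real) ^ b * 2 ^ (l div 2 - b)"
        using l(2) by (simp flip: power_add)
      then show ?thesis using l(2) by (simp add: u_def m_def)
    qed
    have mr: "m (l div 2) < r" using l by (auto simp: m_def R_def)
    have al: "?a f l \<le> (M * 2 ^ m (l div 2)) powr (- p)"
      using freq_level_le[OF f N p(1) u, of l] unfolding w .
    show ?thesis
      by (rule level_error_coarse[OF p N n M Mp E B_eq nE r_least[OF mr] a al
            less_imp_le[OF d] dt[unfolded \<epsilon>_def]])
  qed
  have fine: "u * 2 ^ (l div 2) * level_error (?a f l) (d l) (t l) \<le> ?C * g l"
    if f: "f \<in> BpN N p" and l: "l div 2 < b" for f l
  proof -
    have w: "u * 2 ^ (l div 2) = M / 2 ^ m (l div 2)"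
    proof -
      have "(2 :: real) ^ b = 2 ^ (l div 2) * 2 ^ (b - l div 2)"
        using l by (simp flip: power_add)
      then show ?thesis using l by (simp add: u_def m_def)
    qed
    have al: "?a f l \<le> (M / 2 ^ m (l div 2)) powr (- p)"
      using freq_level_le[OF f N p(1) u, of l] unfolding w .
    show ?thesis unfolding w g_powr \<epsilon>_def
      by (rule level_error_fine[OF p n M E a al less_imp_le[OF d] dt[unfolded \<epsilon>_def]])
  qed
  have C: "?C \<ge> 0" using M E by simp
  have "min_qerr {..<N} (SN N) (BpN N p) n \<le> ereal (u + ?C * (2 * H))"
  proof (rule min_qerr_le_counting[where L = "R * 2" and chi = "level u" and w = "weight u" and d = d and t = t, OF N])
    show "1 \<le> R * 2" using b by (simp add: R_def)
    have "real (\<Sum>l<R * 2. 2 * (2 ^ t l - 1)) \<le> (\<Sum>l<R * 2. 2 * x l)"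
      unfolding of_nat_sum
    proof (rule sum_mono)
      fix l
      have "real (2 ^ t l - 1) = 2 ^ t l - 1" by (simp add: of_nat_diff)
      also have "\<dots> \<le> x l" using t(1)[of l] x[of l] by (simp add: max_def split: if_splits)
      finally show "real (2 * (2 ^ t l - 1)) \<le> 2 * x l" by simp
    qed
    also have "\<dots> = real n / (2 * H) * (\<Sum>l<R * 2. g l)"
      by (simp add: x_def sum_distrib_left)
    also have "\<dots> \<le> real n / (2 * H) * (2 * H)"
      using g_sum H by (intro mult_left_mono) auto
    also have "\<dots> = real n" using H by simp
    finally show "(\<Sum>l<R * 2. 2 * (2 ^ t l - 1)) \<le> n" unfolding of_nat_le_iff .
    show "d l > 0" for l by (rule d)
    have "(\<Sum>l<R * 2. 2 / d l) = 1 / (8 * H) * (\<Sum>l<R * 2. g l)"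
      by (simp add: d_def sum_distrib_left)
    also have "\<dots> \<le> 1 / (8 * H) * (2 * H)"
      using g_sum H by (intro mult_left_mono) auto
    finally show "(\<Sum>l<R * 2. 2 / d l) \<le> 1 / 4" using H by simp
  next
    fix f \<rho>
    assume f: "f \<in> BpN N p"
      and \<rho>: "\<And>l. l < R * 2 \<Longrightarrow> \<bar>\<rho> l - ?a f l\<bar> \<le> level_error (?a f l) (d l) (t l)"
      and exact: "\<And>l. l < R * 2 \<Longrightarrow> level_error (?a f l) (d l) (t l) < 1 / real N \<Longrightarrow> \<rho> l = ?a f l"
    have "\<bar>(\<Sum>l<R * 2. weight u l * ?a f l) - (\<Sum>l<R * 2. weight u l * \<rho> l)\<bar>
      \<le> (\<Sum>l<R * 2. \<bar>weight u l * ?a f l - weight u l * \<rho> l\<bar>)"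
      unfolding sum_subtractf[symmetric] by (rule sum_abs)
    also have "\<dots> \<le> (\<Sum>l<R * 2. ?C * g l)"
    proof (rule sum_mono)
      fix l assume "l \<in> {..<R * 2}"
      then have l: "l < R * 2" by simp
      have abs: "\<bar>weight u l * ?a f l - weight u l * \<rho> l\<bar> = u * 2 ^ (l div 2) * \<bar>\<rho> l - ?a f l\<bar>"
        using u by (simp add: weight_def abs_mult abs_minus_commute flip: right_diff_distrib)
      show "\<bar>weight u l * ?a f l - weight u l * \<rho> l\<bar> \<le> ?C * g l"
      proof (cases "l div 2 < b")
        case True
        have "\<bar>weight u l * ?a f l - weight u l * \<rho> l\<bar> \<le> u * 2 ^ (l div 2) * level_error (?a f l) (d l) (t l)"
          unfolding abs using u \<rho>[OF l] by (intro mult_left_mono) auto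
        then show ?thesis using fine[OF f True] by linarith
      next
        case False
        then have "\<rho> l = ?a f l" using exact[OF l] coarse[OF f l] by blast
        then show ?thesis using mult_nonneg_nonneg[OF C less_imp_le[OF g]] unfolding abs by simp
      qed
    qed
    also have "\<dots> \<le> ?C * (2 * H)"
      unfolding sum_distrib_left[symmetric] by (rule mult_left_mono[OF g_sum C])
    finally have "\<bar>(\<Sum>l<R * 2. weight u l * ?a f l) - (\<Sum>l<R * 2. weight u l * \<rho> l)\<bar> \<le> ?C * (2 * H)" .
    moreover have "\<bar>SN N f - (\<Sum>l<R * 2. weight u l * ?a f l)\<bar> \<le> u"
      using BpN_abs_le[OF f N p(1)] r uR by (intro mean_levels N u) fastforce
    ultimately show "\<bar>SN N f - (\<Sum>l<R * 2. weight u l * \<rho> l)\<bar> \<le> u + ?C * (2 * H)" by linarith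
  qed
  also have "u + ?C * (2 * H) \<le> (1 + 32 * H * (E * B powr (2 / p - 1) + B powr (2 / p))) * X"
  proof -
    have "M powr (1 - p / 2) = (B * real N / real n) powr (2 / p - 1)"
      using p unfolding M_def powr_powr by (intro arg_cong2[where f = "(powr)"] refl) (simp add: field_simps)
    also have "\<dots> = B powr (2 / p - 1) * real N powr (2 / p - 1) * real n powr (1 - 2 / p)"
      using B by (simp add: powr_divide powr_mult powr_diff)
    finally have "M powr (1 - p / 2) * (E / real n)
       = E * B powr (2 / p - 1) * (real N powr (2 / p - 1) * (real n powr (1 - 2 / p) / real n))"
      by simp
    also have "real n powr (1 - 2 / p) / real n = real n powr (- 2 / p)"
      using n powr_diff[of "real n" "1 - 2 / p" 1] by simp
    finally have 1: "M powr (1 - p / 2) * (E / real n) = E * B powr (2 / p - 1) * X"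
      by (simp add: X_def mult.commute)
    \<comment> \<open>Up to constants this quadratic term is \<open>X * N / n^2\<close>, which is
      where \<open>nE\<close> enters.\<close>
    have "M * (E / real n)\<^sup>2 = B powr (2 / p) * real N powr (2 / p) * real n powr (- 2 / p) * (E\<^sup>2 / (real n)\<^sup>2)"
      using B by (simp add: M_def powr_divide powr_mult powr_minus_divide power_divide)
    also have "\<dots> = B powr (2 / p) * X * (E\<^sup>2 * real N / (real n)\<^sup>2)"
      using N powr_add[of "real N" "2 / p - 1" 1] by (simp add: X_def)
    also have "\<dots> \<le> B powr (2 / p) * X * 1"
    proof (rule mult_left_mono)
      have "(E * sqrt (real N))\<^sup>2 \<le> (real n)\<^sup>2" using nE E by (intro power_mono) auto
      then show "E\<^sup>2 * real N / (real n)\<^sup>2 \<le> 1" using n by (simp add: power_mult_distrib)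
    qed (use X in simp)
    finally have 2: "M * (E / real n)\<^sup>2 \<le> B powr (2 / p) * X" by simp
    have "u + ?C * (2 * H) \<le> X + 16 * (E * B powr (2 / p - 1) * X + B powr (2 / p) * X) * (2 * H)"
      using b(2) 1 2 H by (intro add_mono mult_right_mono mult_left_mono) (auto simp: u_def)
    then show ?thesis by (simp add: algebra_simps)
  qed
  finally show ?thesis by (simp add: ereal_less_eq(3))
qed

theorem theorem3:
  fixes p :: real
  assumes "1 \<le> p" and "p < 2"
  shows "\<exists>c0 > 0. \<exists>c > 0. \<forall>n N :: nat. 1 \<le> n \<longrightarrow> 1 \<le> N \<longrightarrow> real n \<ge> c0 * sqrt (real N) \<longrightarrow>
           min_qerr {..<N} (SN N) (BpN N p) n
             \<le> ereal (c * real n powr (- 2 / p) * real N powr (2 / p - 1)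
                      * (max (log 2 (real n / sqrt (real N))) 1) powr (2 / p - 1))"
proof -
  define H where "H = 2 / (1 - 2 powr (- ((2 - p) / 8)))"
  define c where "c = 1 + 32 * H * (128 * H\<^sup>2 * (64 * (128 * H\<^sup>2)) powr (2 / p - 1) + (64 * (128 * H\<^sup>2)) powr (2 / p))"
  have "2 powr (- ((2 - p) / 8)) < 1" using assms by (intro powr_less_one) auto
  then have H: "H > 0" by (simp add: H_def)
  have "c > 0" unfolding c_def using H
    by (intro add_pos_nonneg mult_nonneg_nonneg add_nonneg_nonneg) auto
  show ?thesis
  proof (rule exI[of _ "128 * H\<^sup>2"], intro conjI exI[of _ c] allI impI)
    show "128 * H\<^sup>2 > 0" using H by simp
  next
    fix n N :: nat
    assume nN: "1 \<le> n" "1 \<le> N" "real n \<ge> 128 * H\<^sup>2 * sqrt (real N)"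
    let ?X = "real n powr (- 2 / p) * real N powr (2 / p - 1)"
    let ?L = "(max (log 2 (real n / sqrt (real N))) 1) powr (2 / p - 1)"
    \<comment> \<open>Base at least 1 and nonnegative exponent: the logarithmic factor can only
      enlarge the bound.\<close>
    have "?L \<ge> 1" using assms by (intro ge_one_powr_ge_zero) auto
    then have le: "c * ?X * 1 \<le> c * ?X * ?L" using \<open>c > 0\<close> by (intro mult_left_mono) auto
    have "min_qerr {..<N} (SN N) (BpN N p) n \<le> ereal (c * ?X)"
      unfolding c_def H_def by (rule min_qerr_SN_le[OF assms nN(2,1) nN(3)[unfolded H_def]])
    also have "\<dots> \<le> ereal (c * real n powr (- 2 / p) * real N powr (2 / p - 1) * ?L)"
      using le by (simp only: ereal_less_eq(3) mult.assoc mult_1_right)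
    finally show "min_qerr {..<N} (SN N) (BpN N p) n
      \<le> ereal (c * real n powr (- 2 / p) * real N powr (2 / p - 1) * ?L)" .
  qed (fact \<open>c > 0\<close>)
qed

end
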